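(* Let $A>0$, $V\in\mathbb{R}$, and let $$q(x)=A\,\frac{e^{iVx}}{\cosh(Ax)},\qquad x\in\mathbb{R}.$$ Let $c\in\mathbb{R}^+\cup i\mathbb{R}^+$ (i.e. $c>0$ or $c/i>0$). Then for $k\in\mathbb{R}$ the scattering coefficients $a(k,c)$, $b(k,c)$ of $q$ with coupling $c$ are $$a(k,c)=\frac{\Gamma\left(\frac12-\frac iA\left(k+\frac V2\right)\right)^2}{\Gamma\left(\frac12-ic-\frac iA\left(k+\frac V2\right)\right)\Gamma\left(\frac12+ic-\frac iA\left(k+\frac V2\right)\right)},$$ $$b(k,c)=-\frac{\sin(i\pi c)}{ic}\,\frac{1}{\cosh\frac{\pi}{A}\left(k+\frac V2\right)},$$ where $\Gamma$ is the Gamma function. In particular, for $c=i$, one has $b(k,i)=0$ and $a(k,i)=\frac{k-k_1}{k-k_1^*}$ with $k_1=-\frac V2+\frac{iA}{2}$.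
   Context: The nonlinear Schrödinger equation is $i\partial_tq+\partial_x^2q-2c^2|q|^2q=0$; $c>0$ is the defocusing case and $c\in i\mathbb{R}^+$ the focusing case. The given $q$ is the time-zero profile of a one-soliton solution for $c=i$ (with its arbitrary phase and position shifts set to zero). Given a rapidly decreasing field $q(x)$ and a coupling $c$, set $W(x)=c\begin{pmatrix}0&q(x)\\ q^*(x)&0\end{pmatrix}$ and $\sigma_3=\mathrm{diag}(1,-1)$. For $k\in\mathbb{R}$ the Jost solution $\Psi^+(x,k)$ is the unique $2\times2$ matrix solution of $\Psi_x=(-ik\sigma_3+W(x))\Psi$ with $\lim_{x\to+\infty}e^{ikx\sigma_3}\Psi^+(x,k)=\mathbf{1}_2$. The scattering matrix is $S(k,c)=\lim_{x\to-\infty}e^{ikx\sigma_3}\Psi^+(x,k)$. The scattering coefficients are its second-column entries: $b(k,c)=S_{12}(k,c)$ and $a(k,c)=S_{22}(k,c)$.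
   Formalization: The printed b(k,c) lacks a factor c when b = S_12: the theorem proved has b(k,c) = -(sin(iπc)/i)/cosh(π(k+V/2)/A). The printed version fails, e.g., for A=1, V=0, k=0, c=2, where |a|²-|b|²=1 forces |b| = sinh 2π. *)

theory Defs
  imports "HOL-Analysis.Analysis"
begin

definition mat2 :: "'a::zero \<Rightarrow> 'a \<Rightarrow> 'a \<Rightarrow> 'a \<Rightarrow> 'a ^ 2 ^ 2" where
  "mat2 p q r s = vector [vector [p, q], vector [r, s]]"

definition sigma3 :: "complex ^ 2 ^ 2" where
  "sigma3 = mat2 1 0 0 (-1)"

definition potential :: "(real \<Rightarrow> complex) \<Rightarrow> complex \<Rightarrow> real \<Rightarrow> complex ^ 2 ^ 2" where
  "potential q c x = mat c ** mat2 0 (q x) (cnj (q x)) 0"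

text \<open>The matrix exponential of \<open>i k x \<sigma>\<^sub>3\<close>, which is diagonal.\<close>

definition exp_sigma3 :: "real \<Rightarrow> real \<Rightarrow> complex ^ 2 ^ 2" where
  "exp_sigma3 k x = mat2 (exp (\<i> * of_real (k * x))) 0 0 (exp (- \<i> * of_real (k * x)))"

definition jost_plus_solution ::
  "(real \<Rightarrow> complex) \<Rightarrow> real \<Rightarrow> complex \<Rightarrow> (real \<Rightarrow> complex ^ 2 ^ 2) \<Rightarrow> bool" where
  "jost_plus_solution q k c \<Psi> \<longleftrightarrow>
     (\<forall>x. (\<Psi> has_vector_derivative
            (mat (- \<i> * of_real k) ** sigma3 + potential q c x) ** \<Psi> x) (at x)) \<and>
     ((\<lambda>x. exp_sigma3 k x ** \<Psi> x) \<longlongrightarrow> mat 1) at_top"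

definition jost_plus :: "(real \<Rightarrow> complex) \<Rightarrow> real \<Rightarrow> complex \<Rightarrow> real \<Rightarrow> complex ^ 2 ^ 2" where
  "jost_plus q k c = (THE \<Psi>. jost_plus_solution q k c \<Psi>)"

definition scattering_matrix :: "(real \<Rightarrow> complex) \<Rightarrow> real \<Rightarrow> complex \<Rightarrow> complex ^ 2 ^ 2" where
  "scattering_matrix q k c = Lim at_bot (\<lambda>x. exp_sigma3 k x ** jost_plus q k c x)"

definition scattering_a :: "(real \<Rightarrow> complex) \<Rightarrow> real \<Rightarrow> complex \<Rightarrow> complex" where
  "scattering_a q k c = scattering_matrix q k c $ 2 $ 2"

definition scattering_b :: "(real \<Rightarrow> complex) \<Rightarrow> real \<Rightarrow> complex \<Rightarrow> complex" where
  "scattering_b q k c = scattering_matrix q k c $ 1 $ 2"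

definition soliton_profile :: "real \<Rightarrow> real \<Rightarrow> real \<Rightarrow> complex" where
  "soliton_profile A V x = of_real A * exp (\<i> * of_real (V * x)) / of_real (cosh (A * x))"

end

(* With l = 2k + V and s = 1/(1 + exp(2Ax)), the second column of exp(ikx sigma3) Psi is (v, u), where u
   solves a second-order equation in x that becomes the hypergeometric equation in s; the Jost
   normalisation at x = +infinity selects u = F(ic, -ic; gamma; s) with gamma = 1/2 - il/(2A), and v is a
   multiple of F'(s). The first column is (u, v) with l replaced by -l. As x tends to -infinity, s tends
   to 1: Gauss's summation theorem gives a. The derivative F' diverges at s = 1 like
   (1 - s) powr (gamma - 1); an Abelian theorem reads off the constant from the asymptotics of the Taylor
   coefficients, and the reflection formula turns it into b. Uniqueness of the Jost solution follows from the
   constancy of Wronskians. *)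
theory Submission
  imports Defs
begin

section \<open>Gauss's summation theorem\<close>

text \<open>Eliminating v from u' = cA exp(-ilx) v / cosh(Ax) and v' = cA exp(ilx) u / cosh(Ax)
  gives u'' + (il + A tanh(Ax)) u' = (cA / cosh(Ax))^2 u. With s' = -2As(1 - s), tanh(Ax) = 1 - 2s
  and 1 / cosh(Ax)^2 = 4s(1 - s) this becomes s(1 - s)F'' + (\<gamma> - s)F' = c^2 F. So \<alpha> +
  \<beta> = 0 and \<alpha>\<beta> = c^2, whence the parameters ic and -ic. The excess \<gamma> -
  \<alpha> - \<beta> is then \<gamma> itself, of real part 1/2: the series of F converges absolutely
  at s = 1, but the coefficients of F' decay in general only like n^(-\<gamma>). The obstacle is
  therefore b, the limit of a vanishing factor exp(ilx) / cosh(Ax) times a generally unbounded F'.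
  Constants are carried as reciprocal Gamma values, which are entire. Terminating series, such as
  the one for c = i, thus need no separate case: their constant is 0.\<close>

definition hypergeo :: "complex \<Rightarrow> complex \<Rightarrow> complex \<Rightarrow> complex fps" where
  "hypergeo \<alpha> \<beta> \<gamma> = Abs_fps (\<lambda>n. pochhammer \<alpha> n * pochhammer \<beta> n / (pochhammer \<gamma> n * fact n))"

lemma add_of_nat_neq_0:
  assumes "Re \<gamma> > 0"
  shows "\<gamma> + of_nat n \<noteq> 0"
proof
  assume "\<gamma> + of_nat n = 0"
  hence "Re (\<gamma> + of_nat n) = 0" by simp
  thus False using assms by simp
qed

lemma pochhammer_neq_0_of_Re_pos:
  assumes "Re \<gamma> > 0"
  shows "pochhammer \<gamma> n \<noteq> 0"
  using assms add_of_nat_neq_0[OF assms] by (auto simp: pochhammer_prod)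

lemma Re_pos_not_nonpos_Ints:
  assumes "Re \<gamma> > 0"
  shows "\<gamma> \<notin> \<int>\<^sub>\<le>\<^sub>0"
  using assms by (auto elim!: nonpos_Ints_cases)

lemma hypergeo_nth_0 [simp]: "fps_nth (hypergeo \<alpha> \<beta> \<gamma>) 0 = 1"
  by (simp add: hypergeo_def)

lemma hypergeo_nth_Suc:
  assumes "Re \<gamma> > 0"
  shows "(of_nat n + 1) * (\<gamma> + of_nat n) * fps_nth (hypergeo \<alpha> \<beta> \<gamma>) (Suc n)
           = (\<alpha> + of_nat n) * (\<beta> + of_nat n) * fps_nth (hypergeo \<alpha> \<beta> \<gamma>) n"
proof -
  have "1 + complex_of_nat n \<noteq> 0"
    by (metis of_nat_Suc of_nat_eq_0_iff nat.distinct(1))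
  thus ?thesis
    using pochhammer_neq_0_of_Re_pos[OF assms, of n] add_of_nat_neq_0[OF assms, of n]
    by (simp add: hypergeo_def pochhammer_Suc divide_simps)
qed

text \<open>The symbols for \<gamma> and \<gamma> + 1 share all factors but the first and the last,
  so their quotient is \<gamma> / (\<gamma> + n).\<close>

lemma hypergeo_nth_plus1:
  assumes "Re \<gamma> > 0"
  shows "(\<gamma> + of_nat n) * fps_nth (hypergeo \<alpha> \<beta> (\<gamma> + 1)) n = \<gamma> * fps_nth (hypergeo \<alpha> \<beta> \<gamma>) n"
proof -
  have "\<gamma> * pochhammer (\<gamma> + 1) n = pochhammer \<gamma> n * (\<gamma> + of_nat n)"
    using pochhammer_rec[of \<gamma> n] pochhammer_Suc[of \<gamma> n] by simp
  moreover have "pochhammer \<gamma> n \<noteq> 0" "pochhammer (\<gamma> + 1) n \<noteq> 0"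
    using pochhammer_neq_0_of_Re_pos[of \<gamma> n] pochhammer_neq_0_of_Re_pos[of "\<gamma> + 1" n] assms by auto
  ultimately show ?thesis
    by (simp add: hypergeo_def divide_simps)
qed

text \<open>The exponential is \<open>n\<^sup>z\<close> with \<open>z = \<gamma> - \<alpha> - \<beta>\<close>, written as in \<^const>\<open>rGamma_series\<close>; at \<open>n = 0\<close> it is the junk value 1.\<close>

lemma hypergeo_nth_rGamma_series:
  "(of_nat n + 1) * fps_nth (hypergeo \<alpha> \<beta> \<gamma>) (Suc n) * exp ((\<gamma> - \<alpha> - \<beta>) * of_real (ln (real n)))
     = rGamma_series \<alpha> n * rGamma_series \<beta> n / rGamma_series \<gamma> n"
proof -
  have *: "1 + complex_of_nat n \<noteq> 0"
    by (metis of_nat_Suc of_nat_eq_0_iff nat.distinct(1))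
  have "exp ((\<gamma> - \<alpha> - \<beta>) * of_real (ln (real n))) =
    exp (\<gamma> * of_real (ln (real n))) / (exp (\<alpha> * of_real (ln (real n))) * exp (\<beta> * of_real (ln (real n))))"
    by (simp add: algebra_simps flip: exp_diff exp_add)
  thus ?thesis using *
    by (simp add: hypergeo_def rGamma_series_def divide_simps)
qed

text \<open>\<open>rGamma_series z n\<close> contains \<open>pochhammer z (n + 1)\<close>, hence the
  index \<open>Suc n\<close>; the factor n + 1 reduces \<open>fact (Suc n)\<close> to
  \<open>fact n\<close>. The numbers (n + 1) t(n + 1) are also the Taylor coefficients of the
  derivative, and in that role they later determine b.\<close>

lemma hypergeo_nth_asymptotics:
  assumes "Re \<gamma> > 0"
  shows "(\<lambda>n. (of_nat n + 1) * fps_nth (hypergeo \<alpha> \<beta> \<gamma>) (Suc n) *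
                 exp ((\<gamma> - \<alpha> - \<beta>) * of_real (ln (real n))))
           \<longlonglongrightarrow> Gamma \<gamma> * rGamma \<alpha> * rGamma \<beta>"
proof -
  have "rGamma \<gamma> \<noteq> 0"
    using assms by (simp add: rGamma_eq_zero_iff Re_pos_not_nonpos_Ints)
  hence "(\<lambda>n. rGamma_series \<alpha> n * rGamma_series \<beta> n / rGamma_series \<gamma> n)
           \<longlonglongrightarrow> rGamma \<alpha> * rGamma \<beta> / rGamma \<gamma>"
    by (intro tendsto_intros)
  thus ?thesis
    by (simp only: hypergeo_nth_rGamma_series) (simp add: Gamma_def field_simps)
qed

lemma exp_times_ln_tendsto_0:
  assumes "Re \<delta> > 0"
  shows "(\<lambda>n. exp (- \<delta> * of_real (ln (real n)))) \<longlonglongrightarrow> 0"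
proof (rule tendsto_norm_zero_cancel)
  have "filterlim (\<lambda>n. Re \<delta> * ln (real n)) at_top sequentially"
    using assms
    by (intro filterlim_tendsto_pos_mult_at_top[OF tendsto_const]
              filterlim_compose[OF ln_at_top] filterlim_real_sequentially)
  hence "(\<lambda>n. exp (- (Re \<delta> * ln (real n)))) \<longlonglongrightarrow> 0"
    by (intro filterlim_compose[OF exp_at_bot] filterlim_uminus_at_bot_at_top[THEN filterlim_compose])
  thus "(\<lambda>n. norm (exp (- \<delta> * of_real (ln (real n))))) \<longlonglongrightarrow> 0"
    by (simp add: norm_exp_eq_Re)
qed

text \<open>This removes the boundary term at infinity when the contiguous relation is summed by
  telescoping.\<close>

lemma of_nat_times_hypergeo_nth_tendsto_0:
  assumes "Re \<gamma> > 0" "Re (\<gamma> - \<alpha> - \<beta>) > 0"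
  shows "(\<lambda>n. of_nat n * fps_nth (hypergeo \<alpha> \<beta> \<gamma>) n) \<longlonglongrightarrow> 0"
proof -
  have "(\<lambda>n. of_nat (Suc n) * fps_nth (hypergeo \<alpha> \<beta> \<gamma>) (Suc n)) \<longlonglongrightarrow> 0"
    using tendsto_mult[OF hypergeo_nth_asymptotics[OF assms(1), of \<alpha> \<beta>] exp_times_ln_tendsto_0[OF assms(2)]]
    by (simp add: mult.assoc flip: exp_add) (simp add: algebra_simps)
  thus ?thesis
    by (subst (asm) filterlim_sequentially_Suc)
qed

lemma summable_norm_hypergeo_nth:
  assumes "Re \<gamma> > 0" "Re (\<gamma> - \<alpha> - \<beta>) > 0"
  shows "summable (\<lambda>n. norm (fps_nth (hypergeo \<alpha> \<beta> \<gamma>) n))"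
proof -
  define \<sigma> where "\<sigma> = Re (\<gamma> - \<alpha> - \<beta>)"
  define t where "t = fps_nth (hypergeo \<alpha> \<beta> \<gamma>)"
  obtain C where C: "norm ((of_nat n + 1) * t (Suc n) *
                 exp ((\<gamma> - \<alpha> - \<beta>) * of_real (ln (real n)))) \<le> C" for n
    using convergent_imp_Bseq[OF convergentI[OF hypergeo_nth_asymptotics[OF assms(1), of \<alpha> \<beta>]]]
    unfolding t_def Bseq_def by blast
  \<comment> \<open>Boundedness of the normalised coefficients gives decay of order n^(-1 -
    \<sigma>). The index 0 is left out because the exponential is not a power there.\<close>
  have "norm (norm (t (Suc n))) \<le> C * real n powr (- 1 - \<sigma>)" if "n \<ge> 1" for n
  proof -
    have "norm (1 + complex_of_nat n) = 1 + real n"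
      by (metis of_nat_Suc norm_of_nat)
    hence "(1 + real n) * norm (t (Suc n)) * real n powr \<sigma> \<le> C"
      using C[of n] that
      by (simp only: norm_mult norm_exp_eq_Re powr_def \<sigma>_def add.commute[of _ 1]) simp
    moreover have "real n * norm (t (Suc n)) * real n powr \<sigma> \<le> (1 + real n) * norm (t (Suc n)) * real n powr \<sigma>"
      by (intro mult_right_mono) auto
    ultimately have "real n * norm (t (Suc n)) * real n powr \<sigma> \<le> C"
      by linarith
    moreover have "real n powr (- 1 - \<sigma>) = 1 / (real n * real n powr \<sigma>)"
      using that powr_add[of "real n" 1 \<sigma>] powr_minus_divide[of "real n" "1 + \<sigma>"] by simp
    moreover have "real n * real n powr \<sigma> > 0"
      using that by simp
    ultimately show ?thesis
      by (simp add: pos_le_divide_eq mult_ac)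
  qed
  moreover have "summable (\<lambda>n. C * real n powr (- 1 - \<sigma>))"
    using assms(2) by (intro summable_mult) (simp add: summable_real_powr_iff \<sigma>_def)
  ultimately have "summable (\<lambda>n. norm (t (Suc n)))"
    by - (rule summable_comparison_test[where g = "\<lambda>n. C * real n powr (- 1 - \<sigma>)"],
          auto intro!: exI[of _ 1])
  thus ?thesis
    unfolding t_def by (subst (asm) summable_Suc_iff)
qed

text \<open>Convergence at the single point 1 already bounds the radius from below.\<close>

lemma fps_conv_radius_hypergeo:
  assumes "Re \<gamma> > 0" "Re (\<gamma> - \<alpha> - \<beta>) > 0"
  shows "fps_conv_radius (hypergeo \<alpha> \<beta> \<gamma>) \<ge> 1"
  using conv_radius_geI[of "fps_nth (hypergeo \<alpha> \<beta> \<gamma>)" 1]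
    summable_norm_cancel[OF summable_norm_hypergeo_nth[OF assms]]
  by (simp add: fps_conv_radius_def one_ereal_def)

text \<open>The difference of the two series telescopes with potential \<open>- \<gamma> n t\<^sub>n\<close>, \<open>t\<^sub>n\<close> the terms on the left.\<close>

lemma hypergeo_contiguous:
  assumes "Re \<gamma> > 0" "Re (\<gamma> - \<alpha> - \<beta>) > 0"
  shows "\<gamma> * (\<gamma> - \<alpha> - \<beta>) * (\<Sum>n. fps_nth (hypergeo \<alpha> \<beta> \<gamma>) n)
           = (\<gamma> - \<alpha>) * (\<gamma> - \<beta>) * (\<Sum>n. fps_nth (hypergeo \<alpha> \<beta> (\<gamma> + 1)) n)"
proof -
  define t where "t = fps_nth (hypergeo \<alpha> \<beta> \<gamma>)"
  define t' where "t' = fps_nth (hypergeo \<alpha> \<beta> (\<gamma> + 1))"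
  define r where "r n = - \<gamma> * (of_nat n * t n)" for n
  have "\<gamma> * (\<gamma> - \<alpha> - \<beta>) * t n - (\<gamma> - \<alpha>) * (\<gamma> - \<beta>) * t' n = r (Suc n) - r n" for n
  proof -
    \<comment> \<open>Multiplying by the nonzero \<gamma> + n makes both coefficient relations
      polynomial, so the identity follows by \<open>algebra\<close>.\<close>
    have "(\<gamma> + of_nat n) * (\<gamma> * (\<gamma> - \<alpha> - \<beta>) * t n - (\<gamma> - \<alpha>) * (\<gamma> - \<beta>) * t' n)
            = (\<gamma> + of_nat n) * (r (Suc n) - r n)"
      using hypergeo_nth_plus1[OF assms(1), of n \<alpha> \<beta>] hypergeo_nth_Suc[OF assms(1), of n \<alpha> \<beta>]
      unfolding r_def t_def t'_def of_nat_Suc by algebra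
    thus ?thesis
      using add_of_nat_neq_0[OF assms(1)] by simp
  qed
  moreover have "r \<longlonglongrightarrow> 0"
    using tendsto_mult[OF tendsto_const of_nat_times_hypergeo_nth_tendsto_0[OF assms], of "- \<gamma>"]
    unfolding r_def t_def by simp
  hence "(\<lambda>n. r (Suc n) - r n) sums 0"
    using telescope_sums[of r 0] by (simp add: r_def)
  moreover have "t sums suminf t" "t' sums suminf t'"
    unfolding t_def t'_def using assms
    by (intro summable_sums[OF summable_norm_cancel[OF summable_norm_hypergeo_nth]]; simp)+
  hence "(\<lambda>n. \<gamma> * (\<gamma> - \<alpha> - \<beta>) * t n - (\<gamma> - \<alpha>) * (\<gamma> - \<beta>) * t' n) sums
          (\<gamma> * (\<gamma> - \<alpha> - \<beta>) * suminf t - (\<gamma> - \<alpha>) * (\<gamma> - \<beta>) * suminf t')"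
    by (intro sums_diff sums_mult)
  ultimately have "\<gamma> * (\<gamma> - \<alpha> - \<beta>) * suminf t - (\<gamma> - \<alpha>) * (\<gamma> - \<beta>) * suminf t' = 0"
    by (metis (no_types, lifting) ext sums_unique2)
  thus ?thesis
    by (simp add: t_def t'_def)
qed

text \<open>Each use of the contiguous relation raises \<gamma> and the three differences by 1, so
  the factors collect into Pochhammer symbols.\<close>

lemma hypergeo_contiguous_iterated:
  assumes "Re \<gamma> > 0" "Re (\<gamma> - \<alpha> - \<beta>) > 0"
  shows "pochhammer \<gamma> N * pochhammer (\<gamma> - \<alpha> - \<beta>) N * (\<Sum>n. fps_nth (hypergeo \<alpha> \<beta> \<gamma>) n)
           = pochhammer (\<gamma> - \<alpha>) N * pochhammer (\<gamma> - \<beta>) N *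
               (\<Sum>n. fps_nth (hypergeo \<alpha> \<beta> (\<gamma> + of_nat N)) n)"
proof (induction N)
  case (Suc N)
  have "(\<gamma> + of_nat N) * (\<gamma> - \<alpha> - \<beta> + of_nat N) * (\<Sum>n. fps_nth (hypergeo \<alpha> \<beta> (\<gamma> + of_nat N)) n)
      = (\<gamma> - \<alpha> + of_nat N) * (\<gamma> - \<beta> + of_nat N) * (\<Sum>n. fps_nth (hypergeo \<alpha> \<beta> (\<gamma> + of_nat (Suc N))) n)"
    using hypergeo_contiguous[of "\<gamma> + of_nat N" \<alpha> \<beta>] assms by (simp add: algebra_simps)
  with Suc.IH show ?case
    unfolding pochhammer_Suc by algebra
qed simp

text \<open>The term of index 0 is always 1, and all later terms shrink by at least the common
  factor |\<gamma>| / |\<gamma> + N|, which tends to 0.\<close>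

lemma hypergeo_sum_tendsto_1:
  assumes "Re \<gamma> > 0" "Re (\<gamma> - \<alpha> - \<beta>) > 0"
  shows "(\<lambda>N. \<Sum>n. fps_nth (hypergeo \<alpha> \<beta> (\<gamma> + of_nat N)) n) \<longlonglongrightarrow> 1"
proof -
  define t where "t = (\<lambda>N. fps_nth (hypergeo \<alpha> \<beta> (\<gamma> + of_nat N)))"
  define M where "M = (\<Sum>n. norm (t 0 (Suc n)))"
  have summable: "summable (\<lambda>n. norm (t N n))" for N
    unfolding t_def using assms by (intro summable_norm_hypergeo_nth) simp_all
  have le: "norm (t N (Suc n)) \<le> norm \<gamma> / norm (\<gamma> + of_nat N) * norm (t 0 (Suc n))" for N n
  proof -
    \<comment> \<open>Adding N keeps the imaginary part and enlarges the positive real part.\<close>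
    have "norm (\<gamma> + 1 + of_nat i) \<le> norm (\<gamma> + of_nat N + 1 + of_nat i)" for i
      using assms(1) unfolding cmod_def
      by (intro real_sqrt_le_mono add_mono[OF power_mono]) simp_all
    hence "norm (pochhammer (\<gamma> + 1) n) \<le> norm (pochhammer (\<gamma> + of_nat N + 1) n)"
      unfolding pochhammer_prod prod_norm[symmetric] by (intro prod_mono) simp
    moreover have "pochhammer (\<gamma> + 1) n \<noteq> 0" "pochhammer (\<gamma> + of_nat N + 1) n \<noteq> 0"
      using assms by (intro pochhammer_neq_0_of_Re_pos; simp)+
    moreover have "\<gamma> \<noteq> 0" "\<gamma> + of_nat N \<noteq> 0"
      using add_of_nat_neq_0[OF assms(1), of 0] add_of_nat_neq_0[OF assms(1), of N] by auto
    ultimately show ?thesis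
      using divide_left_mono[of "norm (pochhammer (\<gamma> + 1) n)" "norm (pochhammer (\<gamma> + of_nat N + 1) n)"
          "norm (pochhammer \<alpha> (Suc n)) * norm (pochhammer \<beta> (Suc n)) /
             (norm (\<gamma> + of_nat N) * norm (fact (Suc n) :: complex))"]
      unfolding t_def hypergeo_def fps_nth_Abs_fps norm_mult norm_divide
      \<comment> \<open>Splitting off the first factor \<gamma> + N isolates the gain; the other
        factors are compared one by one.\<close>
      unfolding pochhammer_rec[of "\<gamma> + of_nat N"] pochhammer_rec[of "\<gamma> + of_nat 0"] norm_mult
      by (simp add: mult_ac del: fact_Suc)
  qed
  have "norm (suminf (t N) - 1) \<le> norm \<gamma> * M / norm (\<gamma> + of_nat N)" for N
  proof -
    have "suminf (t N) - 1 = (\<Sum>n. t N (Suc n))"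
      using suminf_split_head[OF summable_norm_cancel[OF summable[of N]]] by (simp add: t_def)
    moreover have s: "summable (\<lambda>n. norm (t N (Suc n)))" for N
      using summable[of N] by (subst summable_Suc_iff)
    moreover have "(\<Sum>n. norm (t N (Suc n))) \<le> (\<Sum>n. norm \<gamma> / norm (\<gamma> + of_nat N) * norm (t 0 (Suc n)))"
      by (intro suminf_le le s summable_mult)
    moreover have "\<dots> = norm \<gamma> * M / norm (\<gamma> + of_nat N)"
      using suminf_mult[OF s[of 0], of "norm \<gamma> / norm (\<gamma> + of_nat N)"] by (simp add: M_def)
    ultimately show ?thesis
      using summable_norm[OF s[of N]] by simp
  qed
  moreover have "(\<lambda>N. norm \<gamma> * M / norm (\<gamma> + of_nat N)) \<longlonglongrightarrow> 0"
    by (intro tendsto_divide_0[OF tendsto_const] filterlim_at_top_imp_at_infinity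
          filterlim_compose[OF filterlim_norm_at_top] tendsto_add_filterlim_at_infinity[OF tendsto_const]
          tendsto_of_nat)
  ultimately have "(\<lambda>N. suminf (t N) - 1) \<longlonglongrightarrow> 0"
    by - (rule Lim_null_comparison[of _ "\<lambda>N. norm \<gamma> * M / norm (\<gamma> + of_nat N)"],
          auto intro: always_eventually)
  thus ?thesis
    unfolding t_def by (simp add: LIM_zero_iff)
qed

text \<open>Letting N tend to infinity in the iterated relation turns the Pochhammer symbols, once
  normalised, into reciprocal Gamma values. The powers of n balance because \<gamma> + (\<gamma> -
  \<alpha> - \<beta>) = (\<gamma> - \<alpha>) + (\<gamma> - \<beta>). With \<open>rGamma\<close> the
  formula also covers the case that \<gamma> - \<alpha> or \<gamma> - \<beta> is a pole of
  Gamma.\<close>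

theorem Gauss_hypergeo_sum:
  assumes "Re \<gamma> > 0" "Re (\<gamma> - \<alpha> - \<beta>) > 0"
  shows "(\<Sum>n. fps_nth (hypergeo \<alpha> \<beta> \<gamma>) n)
           = Gamma \<gamma> * Gamma (\<gamma> - \<alpha> - \<beta>) * rGamma (\<gamma> - \<alpha>) * rGamma (\<gamma> - \<beta>)"
proof -
  define G where "G = (\<lambda>N. \<Sum>n. fps_nth (hypergeo \<alpha> \<beta> (\<gamma> + of_nat N)) n)"
  have "rGamma_series \<gamma> n * rGamma_series (\<gamma> - \<alpha> - \<beta>) n * G 0
          = rGamma_series (\<gamma> - \<alpha>) n * rGamma_series (\<gamma> - \<beta>) n * G (Suc n)" for n
  proof -
    have "exp (\<gamma> * of_real (ln (real n))) * exp ((\<gamma> - \<alpha> - \<beta>) * of_real (ln (real n)))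
            = exp ((\<gamma> - \<alpha>) * of_real (ln (real n))) * exp ((\<gamma> - \<beta>) * of_real (ln (real n)))"
      by (simp add: algebra_simps flip: exp_add)
    moreover have "pochhammer \<gamma> (n + 1) * pochhammer (\<gamma> - \<alpha> - \<beta>) (n + 1) * G 0
                     = pochhammer (\<gamma> - \<alpha>) (n + 1) * pochhammer (\<gamma> - \<beta>) (n + 1) * G (Suc n)"
      using hypergeo_contiguous_iterated[OF assms, of "n + 1"] by (simp add: G_def)
    ultimately show ?thesis
      unfolding rGamma_series_def of_real_of_nat_eq
      by (simp add: divide_simps)
  qed
  moreover have "(\<lambda>n. rGamma_series \<gamma> n * rGamma_series (\<gamma> - \<alpha> - \<beta>) n * G 0)
                   \<longlonglongrightarrow> rGamma \<gamma> * rGamma (\<gamma> - \<alpha> - \<beta>) * G 0"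
    by (intro tendsto_intros)
  moreover have "(\<lambda>n. rGamma_series (\<gamma> - \<alpha>) n * rGamma_series (\<gamma> - \<beta>) n * G (Suc n))
                   \<longlonglongrightarrow> rGamma (\<gamma> - \<alpha>) * rGamma (\<gamma> - \<beta>) * 1"
    using hypergeo_sum_tendsto_1[OF assms] unfolding G_def
    by (intro tendsto_intros LIMSEQ_Suc)
  ultimately have "rGamma \<gamma> * rGamma (\<gamma> - \<alpha> - \<beta>) * G 0 = rGamma (\<gamma> - \<alpha>) * rGamma (\<gamma> - \<beta>)"
    using LIMSEQ_unique by fastforce
  moreover have "rGamma \<gamma> \<noteq> 0" "rGamma (\<gamma> - \<alpha> - \<beta>) \<noteq> 0"
    using assms by (intro notI; simp add: rGamma_eq_zero_iff Re_pos_not_nonpos_Ints)+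
  ultimately show ?thesis
    by (simp add: G_def Gamma_def field_simps)
qed

section \<open>Power series at the end of the unit interval\<close>

text \<open>Split the series at an index N beyond which |e n| is below \<epsilon>/2 times q n: the
  tail is at most \<epsilon>/2 times Q, and the head is bounded by a constant that Q
  outgrows.\<close>

lemma power_series_little_o_at_left_1:
  fixes e :: "nat \<Rightarrow> complex" and q :: "nat \<Rightarrow> real"
  assumes q: "\<And>n. q n > 0"
    and e: "(\<lambda>n. e n / of_real (q n)) \<longlonglongrightarrow> 0"
    and Q: "\<And>s. 0 < s \<Longrightarrow> s < 1 \<Longrightarrow> (\<lambda>n. q n * s ^ n) sums Q s"
    and E: "\<And>s. 0 < s \<Longrightarrow> s < 1 \<Longrightarrow> (\<lambda>n. e n * of_real s ^ n) sums E s"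
    and Q_at_top: "filterlim Q at_top (at_left 1)"
  shows "((\<lambda>s. E s / of_real (Q s)) \<longlongrightarrow> 0) (at_left 1)"
proof (rule tendstoI)
  fix \<epsilon> :: real
  assume "\<epsilon> > 0"
  then obtain N where N: "norm (e n / of_real (q n)) < \<epsilon> / 2" if "n \<ge> N" for n
    using LIMSEQ_D[OF e, of "\<epsilon> / 2"] by auto
  define C where "C = (\<Sum>n<N. norm (e n))"
  have bound: "norm (E s) \<le> \<epsilon> / 2 * Q s + C" if s: "0 < s" "s < 1" for s
  proof -
    have "norm (e n * of_real s ^ n) \<le> \<epsilon> / 2 * (q n * s ^ n) + (if n \<in> {..<N} then norm (e n) else 0)" for n
    proof (cases "n < N")
      case True
      have "norm (e n) * s ^ n \<le> norm (e n) * 1"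
        using s by (intro mult_left_mono power_le_one) auto
      moreover have "\<epsilon> / 2 * (q n * s ^ n) \<ge> 0"
        using q[of n] s \<open>\<epsilon> > 0\<close> by simp
      ultimately show ?thesis
        using True s by (simp add: norm_mult norm_power)
    next
      case False
      hence "norm (e n) \<le> \<epsilon> / 2 * q n"
        using N[of n] q[of n] by (simp add: norm_divide divide_simps split: if_splits)
      hence "norm (e n) * s ^ n \<le> \<epsilon> / 2 * q n * s ^ n"
        using s by (intro mult_right_mono) auto
      thus ?thesis
        using False s by (simp add: norm_mult norm_power)
    qed
    moreover have "(\<lambda>n. \<epsilon> / 2 * (q n * s ^ n) + (if n \<in> {..<N} then norm (e n) else 0)) sums (\<epsilon> / 2 * Q s + C)"
      unfolding C_def using s by (intro sums_add sums_mult Q sums_If_finite_set) auto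
    ultimately have "norm (\<Sum>n. e n * of_real s ^ n) \<le> (\<Sum>n. \<epsilon> / 2 * (q n * s ^ n) + (if n \<in> {..<N} then norm (e n) else 0))"
      by (intro norm_suminf_le) (auto simp: sums_iff)
    thus ?thesis
      using E[OF s] \<open>_ sums (\<epsilon> / 2 * Q s + C)\<close> by (simp add: sums_iff)
  qed
  have "eventually (\<lambda>s. Q s > max 0 (2 * C / \<epsilon>)) (at_left 1)"
    using Q_at_top unfolding filterlim_at_top_dense by blast
  moreover have "eventually (\<lambda>s. s \<in> {0<..<1}) (at_left (1 :: real))"
    by (intro eventually_at_left_real) simp
  ultimately show "eventually (\<lambda>s. dist (E s / of_real (Q s)) 0 < \<epsilon>) (at_left 1)"
  proof eventually_elim
    case (elim s)
    hence "Q s > 0" "C < \<epsilon> / 2 * Q s"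
      using \<open>\<epsilon> > 0\<close> by (auto simp: field_simps)
    thus ?case
      using bound[of s] elim by (simp add: norm_divide divide_less_eq)
  qed
qed

text \<open>\<open>rGamma_series z n\<close> has the additional factor z + n; trading it for n costs
  1 / (1 + z/n), which tends to 1.\<close>

lemma pochhammer_over_fact_asymptotics:
  fixes z :: complex
  shows "(\<lambda>n. pochhammer z n / fact n * exp ((1 - z) * of_real (ln (real n)))) \<longlonglongrightarrow> rGamma z"
proof -
  have "(\<lambda>n. rGamma_series z n * (1 / (1 + z / of_nat n))) \<longlonglongrightarrow> rGamma z * (1 / (1 + 0))"
    by (intro tendsto_intros tendsto_divide_0[OF tendsto_const] tendsto_of_nat) simp
  moreover have "eventually (\<lambda>n. rGamma_series z n * (1 / (1 + z / of_nat n)) =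
                    pochhammer z n / fact n * exp ((1 - z) * of_real (ln (real n)))) sequentially"
    \<comment> \<open>Beyond |z| neither n nor z + n can vanish.\<close>
    using eventually_gt_at_top[of "max 0 (nat \<lceil>norm z\<rceil>)"]
  proof eventually_elim
    case (elim n)
    have "exp (of_real (ln (real n))) = complex_of_nat n"
      using elim by (subst exp_of_real) simp
    hence "exp ((1 - z) * of_real (ln (real n))) = of_nat n / exp (z * of_real (ln (real n)))"
      by (simp add: left_diff_distrib exp_diff)
    moreover have "z + of_nat n \<noteq> 0"
    proof
      assume "z + of_nat n = 0"
      hence "norm z = real n"
        by (metis add_eq_0_iff2 norm_minus_cancel norm_of_nat)
      thus False using elim by simp
    qed
    moreover have "of_nat n + z \<noteq> 0"
      using \<open>z + of_nat n \<noteq> 0\<close> by (simp add: add.commute)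
    ultimately show ?case
      using elim by (simp add: rGamma_series_def pochhammer_Suc divide_simps)
         (metis mult.assoc mult.commute add.commute)
  qed
  ultimately show ?thesis
    by (simp add: filterlim_cong[OF refl refl])
qed

lemma negative_binomial_series:
  fixes \<delta> :: complex
  assumes "0 < s" "s < 1"
  shows "(\<lambda>n. pochhammer (1 - \<delta>) n / fact n * of_real s ^ n) sums (of_real (1 - s) powr (\<delta> - 1))"
proof -
  have "((\<delta> - 1) gchoose n) * (- of_real s) ^ n = pochhammer (1 - \<delta>) n / fact n * of_real s ^ n" for n
  proof -
    have "(- 1) ^ n * (- complex_of_real s) ^ n = of_real s ^ n"
      by (metis minus_mult_minus mult_1 power_mult_distrib)
    thus ?thesis
      by (simp add: gbinomial_pochhammer field_simps)
  qed
  thus ?thesis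
    using gen_binomial_complex[of "- of_real s" "\<delta> - 1"] assms by simp
qed

text \<open>
  Subtract the multiple of the binomial series of \<open>(1 - s) powr (\<delta> - 1)\<close> whose coefficients have the same
  leading term, and compare the remainder with the positive series of \<open>(1 - s) powr (Re \<delta> - 1)\<close>.
\<close>

theorem power_series_asymptotics_at_left_1:
  fixes d :: "nat \<Rightarrow> complex" and \<delta> :: complex
  assumes \<delta>: "Re \<delta> < 1"
    and d: "(\<lambda>n. d n * exp (\<delta> * of_real (ln (real n)))) \<longlonglongrightarrow> L"
    and D: "\<And>s. 0 < s \<Longrightarrow> s < 1 \<Longrightarrow> (\<lambda>n. d n * of_real s ^ n) sums D s"
  shows "((\<lambda>s. of_real (1 - s) powr (1 - \<delta>) * D s) \<longlongrightarrow> L * Gamma (1 - \<delta>)) (at_left 1)"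
proof -
  define \<sigma> where "\<sigma> = Re \<delta>"
  define M where "M = L * Gamma (1 - \<delta>)"
  define p where "p n = pochhammer (1 - \<delta>) n / fact n" for n
  define q where "q n = pochhammer (1 - \<sigma>) n / fact n" for n
  define e where "e n = d n - M * p n" for n
  define E where "E s = D s - M * of_real (1 - s) powr (\<delta> - 1)" for s
  define Q where "Q s = (1 - s) powr (\<sigma> - 1)" for s
  have q_complex: "of_real (q n) = pochhammer (1 - complex_of_real \<sigma>) n / fact n" for n
    by (simp add: q_def flip: pochhammer_of_real)
  have "((\<lambda>s. E s / of_real (Q s)) \<longlongrightarrow> 0) (at_left 1)"
  proof (rule power_series_little_o_at_left_1)
    show "q n > 0" for n
      using \<delta> by (simp add: q_def \<sigma>_def pochhammer_pos)
    have "rGamma (1 - \<delta>) \<noteq> 0"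
      using \<delta> by (simp add: rGamma_eq_zero_iff Re_pos_not_nonpos_Ints)
    hence "M * rGamma (1 - \<delta>) = L"
      by (simp add: M_def Gamma_def)
    moreover have "(\<lambda>n. d n * exp (\<delta> * of_real (ln (real n))) - M * (p n * exp (\<delta> * of_real (ln (real n)))))
            \<longlonglongrightarrow> L - M * rGamma (1 - \<delta>)"
      using pochhammer_over_fact_asymptotics[of "1 - \<delta>"] unfolding p_def
      by (intro tendsto_intros d) simp
    ultimately have "(\<lambda>n. e n * exp (\<delta> * of_real (ln (real n)))) \<longlonglongrightarrow> 0"
      by (simp add: e_def algebra_simps)
    moreover have "(\<lambda>n. of_real (q n) * exp (of_real \<sigma> * of_real (ln (real n)))) \<longlonglongrightarrow> rGamma (1 - complex_of_real \<sigma>)"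
      using pochhammer_over_fact_asymptotics[of "1 - of_real \<sigma>"] unfolding q_complex by simp
    moreover have "rGamma (1 - complex_of_real \<sigma>) \<noteq> 0"
      using \<delta> by (simp add: rGamma_eq_zero_iff Re_pos_not_nonpos_Ints \<sigma>_def)
    \<comment> \<open>The powers n^\<delta> and n^\<sigma> have the same modulus. Taking norms
      discards the oscillation, so a positive comparison series suffices.\<close>
    ultimately have "(\<lambda>n. norm (e n * exp (\<delta> * of_real (ln (real n))) /
                           (of_real (q n) * exp (of_real \<sigma> * of_real (ln (real n)))))) \<longlonglongrightarrow> norm (0 / rGamma (1 - complex_of_real \<sigma>))"
      by (intro tendsto_norm tendsto_divide)
    moreover have "norm (e n * exp (\<delta> * of_real (ln (real n))) /
                     (of_real (q n) * exp (of_real \<sigma> * of_real (ln (real n))))) = norm (e n / of_real (q n))" for n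
      by (simp add: norm_mult norm_divide norm_exp_eq_Re \<sigma>_def)
    ultimately show "(\<lambda>n. e n / of_real (q n)) \<longlonglongrightarrow> 0"
      by (simp only: tendsto_norm_zero_iff) (simp add: tendsto_norm_zero_iff)
    show "(\<lambda>n. q n * s ^ n) sums Q s" if "0 < s" "s < 1" for s
    proof -
      have "(\<lambda>n. complex_of_real (q n * s ^ n)) sums of_real (Q s)"
        using negative_binomial_series[OF that, of "of_real \<sigma>"] that
          powr_of_real[of "1 - s" "\<sigma> - 1"]
        by (simp add: q_complex Q_def)
      thus ?thesis
        by (simp only: sums_of_real_iff)
    qed
    show "(\<lambda>n. e n * of_real s ^ n) sums E s" if "0 < s" "s < 1" for s
      using sums_diff[OF D[OF that] sums_mult[OF negative_binomial_series[OF that, of \<delta>], of M]]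
      by (simp add: e_def E_def p_def algebra_simps)
    have "filterlim (\<lambda>s :: real. (1 - s)) (at_right 0) (at_left 1)"
      by (rule filterlim_at_withinI)
         (auto intro!: tendsto_eq_intros eventually_at_leftI[of 0])
    hence "filterlim (\<lambda>s. (1 - \<sigma>) * - ln (1 - s)) at_top (at_left 1)"
      using \<delta> unfolding \<sigma>_def
      by (intro filterlim_tendsto_pos_mult_at_top[OF tendsto_const] filterlim_compose[OF ln_at_0]
            filterlim_uminus_at_top_at_bot[THEN filterlim_compose]) simp
    hence "filterlim (\<lambda>s. exp ((1 - \<sigma>) * - ln (1 - s))) at_top (at_left 1)"
      by (rule filterlim_compose[OF exp_at_top])
    moreover have "eventually (\<lambda>s. exp ((1 - \<sigma>) * - ln (1 - s)) = Q s) (at_left 1)"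
      using eventually_at_left_real[of 0 1]
      by (auto elim!: eventually_mono simp: Q_def powr_def algebra_simps)
    ultimately show "filterlim Q at_top (at_left 1)"
      by (simp add: filterlim_cong[OF refl refl])
  qed
  hence "((\<lambda>s. norm (E s / of_real (Q s))) \<longlongrightarrow> 0) (at_left 1)"
    by (rule tendsto_norm_zero)
  moreover have "eventually (\<lambda>s. s \<in> {0<..<1}) (at_left (1 :: real))"
    by (intro eventually_at_left_real) simp
  \<comment> \<open>The same principle for the functions: (1 - s) powr (1 - \<delta>) and 1 / Q s
    differ by a factor of modulus 1.\<close>
  hence "eventually (\<lambda>s. norm (E s / of_real (Q s)) = norm (of_real (1 - s) powr (1 - \<delta>) * D s - M)) (at_left 1)"
  proof eventually_elim
    case (elim s)
    have "of_real (1 - s) powr (1 - \<delta>) * of_real (1 - s) powr (\<delta> - 1) = 1"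
      using elim by (simp flip: powr_add)
    hence "of_real (1 - s) powr (1 - \<delta>) * D s - M = of_real (1 - s) powr (1 - \<delta>) * E s"
      by (simp add: E_def algebra_simps)
    moreover have "norm (complex_of_real (1 - s) powr (1 - \<delta>)) = (1 - s) powr (1 - \<sigma>)"
      using elim by (subst norm_powr_real_powr) (auto simp: \<sigma>_def)
    moreover have "(1 - s) powr (1 - \<sigma>) = 1 / Q s"
      using elim powr_minus_divide[of "1 - s" "\<sigma> - 1"] by (simp add: Q_def)
    ultimately show ?case
      by (simp add: norm_mult norm_divide Q_def)
  qed
  ultimately have "((\<lambda>s. norm (of_real (1 - s) powr (1 - \<delta>) * D s - M)) \<longlongrightarrow> 0) (at_left 1)"
    by (rule Lim_transform_eventually)
  thus ?thesis
    unfolding M_def by (simp only: tendsto_norm_zero_iff LIM_zero_iff)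
qed

section \<open>The hypergeometric equation and the Jost functions\<close>

text \<open>The coefficient of index n on both sides is exactly the two-term recurrence for the
  hypergeometric coefficients.\<close>

lemma hypergeo_fps_ode:
  fixes \<alpha> \<beta> \<gamma> :: complex
  assumes "Re \<gamma> > 0"
  defines "F \<equiv> hypergeo \<alpha> \<beta> \<gamma>"
  shows "fps_X * ((1 - fps_X) * fps_deriv (fps_deriv F)) +
           (fps_const \<gamma> - fps_const (\<alpha> + \<beta> + 1) * fps_X) * fps_deriv F = fps_const (\<alpha> * \<beta>) * F"
proof (rule fps_ext)
  fix n
  have rec: "(of_nat n + 1) * (\<gamma> + of_nat n) * fps_nth F (Suc n) = (\<alpha> + of_nat n) * (\<beta> + of_nat n) * fps_nth F n"
    unfolding F_def by (rule hypergeo_nth_Suc[OF assms(1)])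
  have "fps_nth (fps_X * ((1 - fps_X) * fps_deriv (fps_deriv F))) n
          = of_nat n * (of_nat n + 1) * fps_nth F (Suc n) - of_nat n * (of_nat n - 1) * fps_nth F n"
    by (cases n; cases "n - 1") (simp_all add: left_diff_distrib fps_X_mult_nth algebra_simps)
  moreover have "fps_nth ((fps_const \<gamma> - fps_const (\<alpha> + \<beta> + 1) * fps_X) * fps_deriv F) n
          = \<gamma> * (of_nat n + 1) * fps_nth F (Suc n) - (\<alpha> + \<beta> + 1) * of_nat n * fps_nth F n"
    by (cases n) (simp_all add: left_diff_distrib mult.assoc fps_X_mult_nth)
  ultimately show "fps_nth (fps_X * ((1 - fps_X) * fps_deriv (fps_deriv F)) +
           (fps_const \<gamma> - fps_const (\<alpha> + \<beta> + 1) * fps_X) * fps_deriv F) n = fps_nth (fps_const (\<alpha> * \<beta>) * F) n"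
    using rec unfolding fps_add_nth fps_mult_left_const_nth by algebra
qed

text \<open>Evaluation respects sums and products only inside the discs of convergence, hence a
  radius bound for every subterm.\<close>

lemma hypergeo_ode:
  fixes \<alpha> \<beta> \<gamma> z :: complex
  assumes "Re \<gamma> > 0" "Re (\<gamma> - \<alpha> - \<beta>) > 0" "norm z < 1"
  defines "F \<equiv> hypergeo \<alpha> \<beta> \<gamma>"
  shows "z * (1 - z) * eval_fps (fps_deriv (fps_deriv F)) z +
           (\<gamma> - (\<alpha> + \<beta> + 1) * z) * eval_fps (fps_deriv F) z = \<alpha> * \<beta> * eval_fps F z"
proof -
  have "ereal (norm z) < 1"
    using assms(3) by (simp add: one_ereal_def)
  hence r: "ereal (norm z) < fps_conv_radius F"
    unfolding F_def by (rule order_less_le_trans[OF _ fps_conv_radius_hypergeo[OF assms(1,2)]])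
  hence r': "ereal (norm z) < fps_conv_radius (fps_deriv F)"
    by (rule order_less_le_trans[OF _ fps_conv_radius_deriv])
  hence r'': "ereal (norm z) < fps_conv_radius (fps_deriv (fps_deriv F))"
    by (rule order_less_le_trans[OF _ fps_conv_radius_deriv])
  have rX: "ereal (norm z) < fps_conv_radius (1 - fps_X :: complex fps)"
    using fps_conv_radius_diff[of 1 "fps_X :: complex fps"] by simp
  have "fps_conv_radius (fps_const (\<alpha> + \<beta> + 1) * fps_X) = \<infinity>"
    using fps_conv_radius_mult[of "fps_const (\<alpha> + \<beta> + 1)" fps_X] by simp
  moreover from this have "fps_conv_radius (fps_const \<gamma> - fps_const (\<alpha> + \<beta> + 1) * fps_X) = \<infinity>"
    using fps_conv_radius_diff[of "fps_const \<gamma>" "fps_const (\<alpha> + \<beta> + 1) * fps_X"] by simp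
  ultimately have rL: "ereal (norm z) < fps_conv_radius (fps_const (\<alpha> + \<beta> + 1) * fps_X)"
    "ereal (norm z) < fps_conv_radius (fps_const \<gamma> - fps_const (\<alpha> + \<beta> + 1) * fps_X)"
    by simp_all
  have rX2: "ereal (norm z) < fps_conv_radius ((1 - fps_X) * fps_deriv (fps_deriv F))"
    using fps_conv_radius_mult[of "1 - fps_X" "fps_deriv (fps_deriv F)"] rX r''
    by (meson min_less_iff_conj order_less_le_trans)
  have rX3: "ereal (norm z) < fps_conv_radius (fps_X * ((1 - fps_X) * fps_deriv (fps_deriv F)))"
    using fps_conv_radius_mult[of fps_X "(1 - fps_X) * fps_deriv (fps_deriv F)"] rX2 by simp
  have rL2: "ereal (norm z) < fps_conv_radius ((fps_const \<gamma> - fps_const (\<alpha> + \<beta> + 1) * fps_X) * fps_deriv F)"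
    using fps_conv_radius_mult[of "fps_const \<gamma> - fps_const (\<alpha> + \<beta> + 1) * fps_X" "fps_deriv F"] rL r'
    by (meson min_less_iff_conj order_less_le_trans)
  show ?thesis
    using arg_cong[OF hypergeo_fps_ode[OF assms(1), of \<alpha> \<beta>], of "\<lambda>f. eval_fps f z"]
    by (simp add: eval_fps_add eval_fps_mult eval_fps_diff r r' r'' rX rX2 rX3 rL rL2 mult.assoc flip: F_def)
qed

section \<open>The substitution from the line to the unit interval\<close>

text \<open>The argument is complex so that complex derivatives of power series can be chained with
  it; only real points are used, where the denominator is nonzero.\<close>

definition logistic :: "real \<Rightarrow> complex \<Rightarrow> complex" where
  "logistic A z = 1 / (1 + exp (2 * of_real A * z))"

lemma cosh_of_real: "cosh (complex_of_real x) = of_real (cosh x)"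
  by (simp add: cosh_field_def flip: exp_of_real)

lemma logistic_of_real: "logistic A (of_real x) = of_real (1 / (1 + exp (2 * A * x)))"
  by (simp add: logistic_def flip: exp_of_real)

lemma logistic_real_bounds:
  fixes t :: real
  shows "0 < 1 / (1 + exp t)" "1 / (1 + exp t) < 1"
proof -
  have "exp t > 0" by simp
  thus "0 < 1 / (1 + exp t)" "1 / (1 + exp t) < 1"
    by (simp_all add: divide_less_eq zero_less_divide_iff del: exp_gt_zero)
qed

lemma norm_logistic_of_real_less_1: "norm (logistic A (of_real x)) < 1"
  using logistic_real_bounds[of "2 * A * x"] unfolding logistic_of_real norm_of_real by simp

lemma one_plus_exp_of_real_neq_0: "1 + exp (2 * complex_of_real A * of_real x) \<noteq> 0"
proof -
  have "1 + exp (2 * A * x) > 0"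
    by (simp add: add_pos_pos)
  hence "complex_of_real (1 + exp (2 * A * x)) \<noteq> 0"
    by (metis of_real_eq_0_iff order_less_irrefl)
  thus ?thesis
    by (simp flip: exp_of_real)
qed

lemma has_field_derivative_logistic:
  "(logistic A has_field_derivative
      - (2 * of_real A * logistic A (of_real x) * (1 - logistic A (of_real x)))) (at (of_real x))"
  unfolding logistic_def using one_plus_exp_of_real_neq_0[of A x]
  by (auto intro!: derivative_eq_intros simp: field_simps power2_eq_square)

text \<open>These identities make every hyperbolic expression algebraic in s and cosh, which lets
  \<open>algebra\<close> verify the differential equations.\<close>

lemma cosh_tanh_logistic:
  assumes "z = of_real x"
  shows "cosh (of_real A * z) \<noteq> 0"
    and "logistic A z * (1 - logistic A z) * (4 * cosh (of_real A * z) ^ 2) = 1"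
    and "sinh (of_real A * z) = (1 - 2 * logistic A z) * cosh (of_real A * z)"
proof -
  define E where "E = exp (of_real A * z)"
  have E: "E \<noteq> 0" "exp (2 * of_real A * z) = E\<^sup>2" "exp (- (of_real A * z)) = 1 / E"
    by (simp_all add: E_def exp_minus inverse_eq_divide mult.assoc flip: exp_double)
  moreover have "1 + E\<^sup>2 \<noteq> 0"
    using one_plus_exp_of_real_neq_0[of A x] E(2) assms by simp
  moreover have cosh: "cosh (of_real A * z) = (1 + E\<^sup>2) / (2 * E)"
    unfolding cosh_field_def E(3) using E(1) by (simp add: divide_simps power2_eq_square flip: E_def)
  moreover have "sinh (of_real A * z) = (E\<^sup>2 - 1) / (2 * E)"
    unfolding sinh_field_def E(3) using E(1) by (simp add: divide_simps power2_eq_square flip: E_def)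
  ultimately show "cosh (of_real A * z) \<noteq> 0"
    and "logistic A z * (1 - logistic A z) * (4 * cosh (of_real A * z) ^ 2) = 1"
    and "sinh (of_real A * z) = (1 - 2 * logistic A z) * cosh (of_real A * z)"
    by (simp_all add: logistic_def divide_simps) algebra+
qed

lemma logistic_tendsto_0:
  assumes "A > 0"
  shows "((\<lambda>x. logistic A (of_real x)) \<longlongrightarrow> 0) at_top"
proof -
  have "filterlim (\<lambda>x. 2 * A * x) at_top at_top"
    using assms by (intro filterlim_tendsto_pos_mult_at_top[OF tendsto_const] filterlim_ident) simp
  hence "filterlim (\<lambda>x. 1 + exp (2 * A * x)) at_top at_top"
    by (intro filterlim_tendsto_add_at_top[OF tendsto_const] filterlim_compose[OF exp_at_top])
  hence "((\<lambda>x. 1 / (1 + exp (2 * A * x))) \<longlongrightarrow> 0) at_top"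
    by (intro tendsto_divide_0[OF tendsto_const] filterlim_at_top_imp_at_infinity)
  hence "((\<lambda>x. complex_of_real (1 / (1 + exp (2 * A * x)))) \<longlongrightarrow> of_real 0) at_top"
    by (rule tendsto_of_real)
  thus ?thesis
    unfolding logistic_of_real of_real_0 .
qed

lemma logistic_at_left_1:
  assumes "A > 0"
  shows "filterlim (\<lambda>x. 1 / (1 + exp (2 * A * x))) (at_left (1 :: real)) at_bot"
proof (rule filterlim_at_withinI)
  have "filterlim (\<lambda>x. 2 * A * x) at_bot at_bot"
    using assms by (intro filterlim_tendsto_pos_mult_at_bot[OF tendsto_const] filterlim_ident) simp
  hence "((\<lambda>x. exp (2 * A * x)) \<longlongrightarrow> 0) at_bot"
    by (rule filterlim_compose[OF exp_at_bot])
  hence "((\<lambda>x. 1 / (1 + exp (2 * A * x))) \<longlongrightarrow> 1 / (1 + 0)) at_bot"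
    by (intro tendsto_intros) auto
  thus "((\<lambda>x. 1 / (1 + exp (2 * A * x))) \<longlongrightarrow> 1) at_bot"
    by simp
  show "eventually (\<lambda>x. 1 / (1 + exp (2 * A * x)) \<in> {..<1} - {1}) at_bot"
    using logistic_real_bounds(2) by (intro always_eventually) (auto simp: less_le)
qed

section \<open>The Jost functions of the soliton profile and their limits\<close>

definition soliton_fps :: "real \<Rightarrow> real \<Rightarrow> complex \<Rightarrow> complex fps" where
  "soliton_fps A l c = hypergeo (\<i> * c) (- \<i> * c) (1 / 2 - \<i> * of_real (l / (2 * A)))"

definition soliton_u :: "real \<Rightarrow> real \<Rightarrow> complex \<Rightarrow> complex \<Rightarrow> complex" where
  "soliton_u A l c z = eval_fps (soliton_fps A l c) (logistic A z)"

text \<open>Obtained by solving u' = cA exp(-ilx) v / cosh(Ax) for v: the chain rule gives u' =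
  -2As(1 - s)F'(s), and 4s(1 - s)cosh(Ax)^2 = 1 removes s(1 - s).\<close>

definition soliton_v :: "real \<Rightarrow> real \<Rightarrow> complex \<Rightarrow> complex \<Rightarrow> complex" where
  "soliton_v A l c z = - (exp (\<i> * of_real l * z) / (2 * c * cosh (of_real A * z)) *
     eval_fps (fps_deriv (soliton_fps A l c)) (logistic A z))"

lemma soliton_fps_conv_radius:
  assumes "norm z < 1"
  shows "ereal (norm z) < fps_conv_radius (soliton_fps A l c)"
proof -
  have "ereal (norm z) < 1"
    using assms by (simp add: one_ereal_def)
  thus ?thesis
    unfolding soliton_fps_def by (rule order_less_le_trans[OF _ fps_conv_radius_hypergeo]) simp_all
qed

lemma soliton_fps_deriv_conv_radius:
  assumes "norm z < 1"
  shows "ereal (norm z) < fps_conv_radius (fps_deriv (soliton_fps A l c))"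
  by (rule order_less_le_trans[OF soliton_fps_conv_radius[OF assms] fps_conv_radius_deriv])

lemma has_vector_derivative_soliton_u:
  assumes "c \<noteq> 0"
  shows "((\<lambda>x. soliton_u A l c (of_real x)) has_vector_derivative
           c * of_real A * exp (- \<i> * of_real (l * x)) / of_real (cosh (A * x)) * soliton_v A l c (of_real x)) (at x)"
proof (rule has_vector_derivative_real_field)
  define z where "z = complex_of_real x"
  define s where "s = logistic A z"
  define F' where "F' = eval_fps (fps_deriv (soliton_fps A l c)) s"
  have "norm s < 1"
    unfolding s_def z_def by (rule norm_logistic_of_real_less_1)
  hence "(soliton_u A l c has_field_derivative F' * - (2 * of_real A * s * (1 - s))) (at z)"
    unfolding soliton_u_def[abs_def] F'_def s_def z_def
    by (intro DERIV_chain2[OF has_field_derivative_eval_fps has_field_derivative_logistic]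
          soliton_fps_conv_radius)
  moreover have "F' * - (2 * of_real A * s * (1 - s)) =
    c * of_real A * exp (- \<i> * of_real (l * x)) / of_real (cosh (A * x)) * soliton_v A l c z"
  proof -
    have "exp (- \<i> * of_real (l * x)) * exp (\<i> * of_real l * z) = 1"
      by (simp add: z_def flip: exp_add)
    moreover have "complex_of_real (cosh (A * x)) = cosh (of_real A * z)"
      by (simp add: z_def flip: cosh_of_real)
    moreover have "soliton_v A l c z = - (exp (\<i> * of_real l * z) / (2 * c * cosh (of_real A * z)) * F')"
      by (simp add: soliton_v_def F'_def s_def)
    ultimately show ?thesis
      using cosh_tanh_logistic(1,2)[OF z_def, of A] assms
      by (simp add: divide_simps flip: s_def) algebra
  qed
  ultimately show "(soliton_u A l c has_field_derivative c * of_real A * exp (- \<i> * of_real (l * x)) /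
      of_real (cosh (A * x)) * soliton_v A l c (of_real x)) (at (of_real x))"
    by (simp add: z_def)
qed

lemma has_vector_derivative_soliton_v:
  assumes "c \<noteq> 0" "A \<noteq> 0"
  shows "((\<lambda>x. soliton_v A l c (of_real x)) has_vector_derivative
           c * of_real A * exp (\<i> * of_real (l * x)) / of_real (cosh (A * x)) * soliton_u A l c (of_real x)) (at x)"
proof (rule has_vector_derivative_real_field)
  define z where "z = complex_of_real x"
  define s where "s = logistic A z"
  define F where "F = eval_fps (soliton_fps A l c) s"
  define F' where "F' = eval_fps (fps_deriv (soliton_fps A l c)) s"
  define F'' where "F'' = eval_fps (fps_deriv (fps_deriv (soliton_fps A l c))) s"
  define C where "C = cosh (of_real A * z)"
  define S where "S = sinh (of_real A * z)"
  define e where "e = exp (\<i> * of_real l * z)"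
  have s: "norm s < 1"
    unfolding s_def z_def by (rule norm_logistic_of_real_less_1)
  have C: "C \<noteq> 0" and S: "S = (1 - 2 * s) * C"
    using cosh_tanh_logistic(1,3)[OF z_def, of A] by (simp_all add: C_def S_def s_def)
  have F': "((\<lambda>w. eval_fps (fps_deriv (soliton_fps A l c)) (logistic A w)) has_field_derivative
          F'' * - (2 * of_real A * s * (1 - s))) (at z)"
    using s unfolding F''_def s_def z_def
    by (intro DERIV_chain2[OF has_field_derivative_eval_fps has_field_derivative_logistic]
          soliton_fps_deriv_conv_radius)
  have "(soliton_v A l c has_field_derivative
      - ((\<i> * of_real l * e * (2 * c * C) - e * (2 * c * (of_real A * S))) / (2 * c * C) ^ 2 * F'
         + e / (2 * c * C) * (F'' * - (2 * of_real A * s * (1 - s))))) (at z)"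
    unfolding soliton_v_def[abs_def]
    by (rule DERIV_minus DERIV_cong[OF DERIV_mult[OF DERIV_divide F']] derivative_eq_intros refl
        | (use C assms(1) in \<open>simp add: C_def S_def s_def e_def F'_def power2_eq_square mult_ac\<close>; fail))+
  moreover have "- ((\<i> * of_real l * e * (2 * c * C) - e * (2 * c * (of_real A * S))) / (2 * c * C) ^ 2 * F'
         + e / (2 * c * C) * (F'' * - (2 * of_real A * s * (1 - s)))) = c * of_real A * e / C * F"
  proof -
    define \<gamma> where "\<gamma> = 1 / 2 - \<i> * complex_of_real (l / (2 * A))"
    have "\<i> * c * (\<i> * c) = \<i>\<^sup>2 * c\<^sup>2"
      by algebra
    \<comment> \<open>Here \<alpha> + \<beta> + 1 = 1 and \<alpha>\<beta> = c^2; the choice of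
      \<gamma> enters through il = A(1 - 2\<gamma>).\<close>
    hence "s * (1 - s) * F'' + (\<gamma> - s) * F' = c\<^sup>2 * F"
      using hypergeo_ode[of \<gamma> "\<i> * c" "- \<i> * c" s] s
      by (simp add: F_def F'_def F''_def \<gamma>_def soliton_fps_def)
    moreover have "\<i> * of_real l = of_real A * (1 - 2 * \<gamma>)"
      using assms(2) by (simp add: \<gamma>_def)
    ultimately have *: "(\<i> * of_real l - of_real A * (1 - 2 * s)) * F' - 2 * of_real A * s * (1 - s) * F''
        = - 2 * of_real A * c\<^sup>2 * F"
      by algebra
    have "- ((\<i> * of_real l * e * (2 * c * C) - e * (2 * c * (of_real A * S))) / (2 * c * C) ^ 2 * F'
         + e / (2 * c * C) * (F'' * - (2 * of_real A * s * (1 - s))))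
       = - (e / (2 * c * C)) * ((\<i> * of_real l - of_real A * (1 - 2 * s)) * F' - 2 * of_real A * s * (1 - s) * F'')"
      unfolding S using C assms(1) by (simp add: divide_simps power2_eq_square) algebra
    also have "\<dots> = c * of_real A * e / C * F"
      unfolding * using C assms(1) by (simp add: divide_simps power2_eq_square)
    finally show ?thesis .
  qed
  moreover have "complex_of_real (cosh (A * x)) = C"
    by (simp add: C_def z_def flip: cosh_of_real)
  moreover have "exp (\<i> * of_real (l * x)) = e"
    by (simp add: e_def z_def mult_ac)
  moreover have "soliton_u A l c (of_real x) = F"
    by (simp add: soliton_u_def F_def s_def z_def)
  ultimately show "(soliton_v A l c has_field_derivative c * of_real A * exp (\<i> * of_real (l * x)) /
      of_real (cosh (A * x)) * soliton_u A l c (of_real x)) (at (of_real x))"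
    by (simp add: z_def)
qed

lemma soliton_u_at_top:
  assumes "A > 0"
  shows "((\<lambda>x. soliton_u A l c (of_real x)) \<longlongrightarrow> 1) at_top"
proof -
  have "isCont (eval_fps (soliton_fps A l c)) 0"
    by (intro continuous_eval_fps soliton_fps_conv_radius) simp
  hence "((\<lambda>x. soliton_u A l c (of_real x)) \<longlongrightarrow> eval_fps (soliton_fps A l c) 0) at_top"
    unfolding soliton_u_def by (rule isCont_tendsto_compose[OF _ logistic_tendsto_0[OF assms]])
  thus ?thesis
    by (simp add: eval_fps_at_0 soliton_fps_def)
qed

lemma soliton_v_at_top:
  assumes "A > 0" "c \<noteq> 0"
  shows "((\<lambda>x. soliton_v A l c (of_real x)) \<longlongrightarrow> 0) at_top"
proof -
  have "isCont (eval_fps (fps_deriv (soliton_fps A l c))) 0"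
    by (intro continuous_eval_fps soliton_fps_deriv_conv_radius) simp
  hence F': "((\<lambda>x. eval_fps (fps_deriv (soliton_fps A l c)) (logistic A (of_real x)))
                 \<longlongrightarrow> eval_fps (fps_deriv (soliton_fps A l c)) 0) at_top"
    by (rule isCont_tendsto_compose[OF _ logistic_tendsto_0[OF assms(1)]])
  have "filterlim (\<lambda>x. A * x) at_top at_top"
    using assms by (intro filterlim_tendsto_pos_mult_at_top[OF tendsto_const] filterlim_ident) simp
  hence "filterlim (\<lambda>x. cosh (A * x)) at_top at_top"
    by (rule filterlim_compose[OF cosh_real_at_top])
  hence "((\<lambda>x. 1 / cosh (A * x)) \<longlongrightarrow> 0) at_top"
    by (intro tendsto_divide_0[OF tendsto_const] filterlim_at_top_imp_at_infinity)
  hence "((\<lambda>x. norm (exp (\<i> * of_real l * complex_of_real x) / cosh (of_real A * of_real x))) \<longlongrightarrow> 0) at_top"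
    by (simp add: norm_divide norm_exp_eq_Re cosh_of_real flip: of_real_mult)
  hence "((\<lambda>x. exp (\<i> * of_real l * complex_of_real x) / cosh (of_real A * of_real x)) \<longlongrightarrow> 0) at_top"
    by (simp only: tendsto_norm_zero_iff)
  hence "((\<lambda>x. - (1 / (2 * c) * (exp (\<i> * of_real l * of_real x) / cosh (of_real A * of_real x)) *
            eval_fps (fps_deriv (soliton_fps A l c)) (logistic A (of_real x))))
     \<longlongrightarrow> - (1 / (2 * c) * 0 * eval_fps (fps_deriv (soliton_fps A l c)) 0)) at_top"
    by (intro tendsto_intros F')
  thus ?thesis
    by (simp add: soliton_v_def)
qed

text \<open>Absolute summability at 1 makes the series continuous on the closed disc, so the limit
  is the sum of the coefficients. Excess and lower parameter both equal \<gamma>, hence the square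
  of Gamma.\<close>

lemma soliton_u_at_bot:
  fixes l :: real and c :: complex
  assumes "A > 0"
  defines "\<gamma> \<equiv> 1 / 2 - \<i> * complex_of_real (l / (2 * A))"
  shows "((\<lambda>x. soliton_u A l c (of_real x)) \<longlongrightarrow>
           (Gamma \<gamma>)\<^sup>2 * rGamma (\<gamma> - \<i> * c) * rGamma (\<gamma> + \<i> * c)) at_bot"
proof -
  define t where "t = fps_nth (soliton_fps A l c)"
  have \<gamma>: "Re \<gamma> > 0" "Re (\<gamma> - \<i> * c - (- \<i> * c)) > 0"
    by (simp_all add: \<gamma>_def)
  have summable: "summable (\<lambda>n. norm (t n))"
    unfolding t_def soliton_fps_def using summable_norm_hypergeo_nth[OF \<gamma>] by (simp add: \<gamma>_def)
  have "continuous_on (cball 0 1) (\<lambda>z. \<Sum>n. t n * z ^ n)"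
  proof (rule uniform_limit_theorem)
    show "uniform_limit (cball 0 1) (\<lambda>N z. \<Sum>n<N. t n * z ^ n) (\<lambda>z. \<Sum>n. t n * z ^ n) sequentially"
    proof (rule Weierstrass_m_test[OF _ summable])
      fix n and z :: complex
      assume "z \<in> cball 0 1"
      thus "norm (t n * z ^ n) \<le> norm (t n)"
        using mult_left_mono[OF power_le_one[of "norm z" n], of "norm (t n)"]
        by (simp add: norm_mult norm_power)
    qed
  qed (auto intro!: always_eventually continuous_intros)
  hence "((\<lambda>z. \<Sum>n. t n * z ^ n) \<longlongrightarrow> (\<Sum>n. t n * 1 ^ n)) (at 1 within cball 0 1)"
    unfolding continuous_on_def by (rule bspec) simp
  moreover have "filterlim (\<lambda>x. logistic A (of_real x)) (at 1 within cball 0 1) at_bot"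
  proof (rule filterlim_at_withinI)
    have "((\<lambda>x. 1 / (1 + exp (2 * A * x))) \<longlongrightarrow> 1) at_bot"
      using logistic_at_left_1[OF assms(1)] by (simp add: filterlim_at)
    hence "((\<lambda>x. complex_of_real (1 / (1 + exp (2 * A * x)))) \<longlongrightarrow> of_real 1) at_bot"
      by (rule tendsto_of_real)
    thus "((\<lambda>x. logistic A (of_real x)) \<longlongrightarrow> 1) at_bot"
      by (simp only: logistic_of_real of_real_1)
    have "logistic A (of_real x) \<in> cball 0 1 - {1}" for x
      using norm_logistic_of_real_less_1[of A x] by auto
    thus "eventually (\<lambda>x. logistic A (of_real x) \<in> cball 0 1 - {1}) at_bot"
      by (intro always_eventually allI)
  qed
  ultimately have "((\<lambda>x. \<Sum>n. t n * logistic A (of_real x) ^ n) \<longlongrightarrow> (\<Sum>n. t n * 1 ^ n)) at_bot"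
    by (rule filterlim_compose)
  moreover have "(\<Sum>n. t n) = (Gamma \<gamma>)\<^sup>2 * rGamma (\<gamma> - \<i> * c) * rGamma (\<gamma> + \<i> * c)"
    using Gauss_hypergeo_sum[OF \<gamma>]
    unfolding t_def soliton_fps_def \<gamma>_def[symmetric] by (simp add: power2_eq_square)
  ultimately show ?thesis
    by (simp add: soliton_u_def eval_fps_def t_def)
qed

text \<open>The prefactor of v is exactly a product of powers of s and 1 - s: the factor (1 - s)
  powr (1 - \<gamma>) compensates the growth of F', and s powr \<gamma> tends to 1. The computation
  rests on 1 - s = exp(2Ax) s.\<close>

lemma exp_over_cosh_eq_logistic_powr:
  fixes l x :: real
  assumes "A \<noteq> 0"
  defines "\<gamma> \<equiv> 1 / 2 - \<i> * complex_of_real (l / (2 * A))" and "s \<equiv> 1 / (1 + exp (2 * A * x))"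
  shows "exp (\<i> * of_real l * of_real x) / (2 * cosh (of_real A * of_real x))
           = of_real s powr \<gamma> * of_real (1 - s) powr (1 - \<gamma>)"
proof -
  have pos: "1 + exp (2 * A * x) > 0"
    by (simp add: add_pos_pos)
  have s: "0 < s" "s < 1"
    unfolding s_def by (rule logistic_real_bounds)+
  have "1 - s = exp (2 * A * x) * s"
    using pos by (simp add: s_def field_simps)
  hence "ln (1 - s) = 2 * A * x + ln s"
    using s by (simp add: ln_mult)
  hence "of_real s powr \<gamma> * of_real (1 - s) powr (1 - \<gamma>)
          = exp (\<gamma> * of_real (ln s) + (1 - \<gamma>) * of_real (2 * A * x + ln s))"
    using s by (simp add: powr_def exp_add Ln_of_real del: of_real_diff)
  also have "\<gamma> * of_real (ln s) + (1 - \<gamma>) * of_real (2 * A * x + ln s)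
          = \<i> * of_real l * of_real x + of_real (ln s + A * x)"
    using assms(1) by (simp add: \<gamma>_def field_simps)
  also have "exp (\<i> * of_real l * of_real x + of_real (ln s + A * x))
          = exp (\<i> * of_real l * of_real x) * of_real (s * exp (A * x))"
    using s by (simp only: exp_add exp_of_real exp_ln)
  also have "s * exp (A * x) = 1 / (2 * cosh (A * x))"
    using pos exp_double[of "A * x"]
    by (simp add: s_def cosh_field_def exp_minus divide_simps mult.assoc) (simp add: algebra_simps power2_eq_square)
  finally show ?thesis
    by (simp flip: cosh_of_real)
qed

text \<open>As a check on the constant, to first order in c the limit is -\<pi>c / cosh(\<pi>l /
  (2A)), which is -c times the integral of A exp(ilx) / cosh(Ax) over the line.\<close>

lemma soliton_v_at_bot:
  fixes l :: real and c :: complex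
  assumes "A > 0" "c \<noteq> 0"
  shows "((\<lambda>x. soliton_v A l c (of_real x)) \<longlongrightarrow>
           - (sin (\<i> * of_real pi * c) / \<i>) / of_real (cosh (pi * l / (2 * A)))) at_bot"
proof -
  define \<gamma> where "\<gamma> = 1 / 2 - \<i> * complex_of_real (l / (2 * A))"
  define F where "F = soliton_fps A l c"
  define d where "d n = (of_nat n + 1) * fps_nth F (Suc n)" for n
  define K where "K = Gamma \<gamma> * rGamma (\<i> * c) * rGamma (- \<i> * c) * Gamma (1 - \<gamma>)"
  define s where "s x = 1 / (1 + exp (2 * A * x))" for x
  have \<gamma>: "Re \<gamma> > 0" "Re \<gamma> < 1"
    by (simp_all add: \<gamma>_def)
  have s_lim: "filterlim s (at_left 1) at_bot"
    unfolding s_def by (rule logistic_at_left_1[OF assms(1)])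
  hence s_lim': "(s \<longlongrightarrow> 1) at_bot"
    by (auto simp: filterlim_at)
  have "((\<lambda>s. of_real (1 - s) powr (1 - \<gamma>) * eval_fps (fps_deriv F) (of_real s)) \<longlongrightarrow> K) (at_left 1)"
    unfolding K_def
  proof (rule power_series_asymptotics_at_left_1[OF \<gamma>(2)])
    show "(\<lambda>n. d n * exp (\<gamma> * of_real (ln (real n)))) \<longlonglongrightarrow> Gamma \<gamma> * rGamma (\<i> * c) * rGamma (- \<i> * c)"
      using hypergeo_nth_asymptotics[OF \<gamma>(1), of "\<i> * c" "- \<i> * c"]
      by (simp add: d_def F_def soliton_fps_def \<gamma>_def)
    show "(\<lambda>n. d n * of_real s ^ n) sums eval_fps (fps_deriv F) (of_real s)" if "0 < s" "s < 1" for s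
      using sums_eval_fps[OF soliton_fps_deriv_conv_radius[of "of_real s" A l c]] that
      by (simp add: d_def F_def add.commute)
  qed
  hence "((\<lambda>x. of_real (1 - s x) powr (1 - \<gamma>) * eval_fps (fps_deriv F) (of_real (s x))) \<longlongrightarrow> K) at_bot"
    by (rule filterlim_compose[OF _ s_lim])
  moreover have "((\<lambda>x. complex_of_real (s x) powr \<gamma>) \<longlongrightarrow> of_real 1 powr \<gamma>) at_bot"
    by (rule tendsto_powr_complex[OF _ tendsto_of_real[OF s_lim'] tendsto_const]) auto
  ultimately have "((\<lambda>x. - (1 / c) * (complex_of_real (s x) powr \<gamma> *
      (of_real (1 - s x) powr (1 - \<gamma>) * eval_fps (fps_deriv F) (of_real (s x))))) \<longlongrightarrow> - (1 / c) * (of_real 1 powr \<gamma> * K)) at_bot"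
    by (intro tendsto_mult tendsto_const)
  moreover have "- (1 / c) * (complex_of_real (s x) powr \<gamma> *
      (of_real (1 - s x) powr (1 - \<gamma>) * eval_fps (fps_deriv F) (of_real (s x)))) = soliton_v A l c (of_real x)" for x
  proof -
    have "exp (\<i> * of_real l * of_real x) / (2 * cosh (of_real A * of_real x))
            = of_real (s x) powr \<gamma> * of_real (1 - s x) powr (1 - \<gamma>)"
      unfolding s_def \<gamma>_def using assms(1) by (intro exp_over_cosh_eq_logistic_powr) simp
    moreover have "soliton_v A l c (of_real x) = - (1 / c) * (exp (\<i> * of_real l * of_real x) /
        (2 * cosh (of_real A * of_real x)) * eval_fps (fps_deriv F) (of_real (s x)))"
      unfolding soliton_v_def logistic_of_real s_def F_def by simp
    ultimately show ?thesis
      by (simp only: mult.assoc)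
  qed
  moreover have "- (1 / c) * (of_real 1 powr \<gamma> * K) =
     - (sin (\<i> * of_real pi * c) / \<i>) / of_real (cosh (pi * l / (2 * A)))"
  proof -
    \<comment> \<open>Shifting -ic to 1 - ic produces a pair of arguments with sum 1, as the
      reflection formula requires.\<close>
    have "rGamma (- \<i> * c) = - \<i> * c * rGamma (1 - \<i> * c)"
      using rGamma_plus1[of "- \<i> * c"] by (simp add: add.commute)
    moreover have "rGamma (\<i> * c) * rGamma (1 - \<i> * c) = sin (\<i> * of_real pi * c) / of_real pi"
      using rGamma_reflection_complex[of "\<i> * c"] by (simp add: mult_ac)
    moreover have "Gamma \<gamma> * Gamma (1 - \<gamma>) = of_real pi / sin (of_real pi * \<gamma>)"
      by (rule Gamma_reflection_complex)
    \<comment> \<open>Since Re \<gamma> = 1/2, the sine is a cosine of a purely imaginary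
      number.\<close>
    moreover have "sin (of_real pi * \<gamma>) = of_real (cosh (pi * l / (2 * A)))"
    proof -
      have "of_real pi * \<gamma> = of_real pi / 2 - \<i> * of_real (pi * l / (2 * A))"
        by (simp add: \<gamma>_def algebra_simps)
      also have "sin \<dots> = cos (\<i> * of_real (pi * l / (2 * A)))"
        by (simp add: sin_diff sin_of_real_pi_half cos_of_real_pi_half)
      also have "\<dots> = of_real (cosh (pi * l / (2 * A)))"
        by (simp add: cosh_conv_cos flip: cosh_of_real)
      finally show ?thesis .
    qed
    moreover have "cosh (pi * l / (2 * A)) \<noteq> 0"
      by simp
    ultimately have "K = - \<i> * c * sin (\<i> * of_real pi * c) / of_real (cosh (pi * l / (2 * A)))"
      unfolding K_def by (simp add: divide_simps) algebra
    thus ?thesis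
      using assms(2) by (simp add: divide_simps)
  qed
  ultimately show ?thesis
    by (simp only:)
qed

section \<open>The Jost matrix\<close>

lemma has_vector_derivative_vec_iff:
  fixes f :: "real \<Rightarrow> 'a::real_normed_vector ^ 'n"
  shows "(f has_vector_derivative d) (at x) \<longleftrightarrow>
           (\<forall>i. ((\<lambda>x. f x $ i) has_vector_derivative d $ i) (at x))"
proof
  assume "(f has_vector_derivative d) (at x)"
  thus "\<forall>i. ((\<lambda>x. f x $ i) has_vector_derivative d $ i) (at x)"
    by (auto intro: bounded_linear.has_vector_derivative[OF bounded_linear_vec_nth])
next
  assume *: "\<forall>i. ((\<lambda>x. f x $ i) has_vector_derivative d $ i) (at x)"
  have "((\<lambda>y. (f y - f x - (y - x) *\<^sub>R d) /\<^sub>R norm (y - x)) \<longlongrightarrow> 0) (at x)"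
    using * by (intro vec_tendstoI) (simp add: has_vector_derivative_def has_derivative_at_within)
  thus "(f has_vector_derivative d) (at x)"
    by (simp add: has_vector_derivative_def has_derivative_at_within bounded_linear_scaleR_left)
qed

lemma has_vector_derivative_two_rows_iff:
  fixes f :: "real \<Rightarrow> 'a::real_normed_vector ^ 'n ^ 2"
  shows "(f has_vector_derivative d) (at x) \<longleftrightarrow>
           (\<forall>j. ((\<lambda>x. f x $ 1 $ j) has_vector_derivative d $ 1 $ j) (at x) \<and>
                ((\<lambda>x. f x $ 2 $ j) has_vector_derivative d $ 2 $ j) (at x))"
  by (simp add: has_vector_derivative_vec_iff forall_2 all_conj_distrib)

lemma tendsto_two_rows_iff:
  fixes f :: "'b \<Rightarrow> 'a::topological_space ^ 'n ^ 2"
  shows "(f \<longlongrightarrow> L) F \<longleftrightarrow>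
           (\<forall>j. ((\<lambda>x. f x $ 1 $ j) \<longlongrightarrow> L $ 1 $ j) F \<and> ((\<lambda>x. f x $ 2 $ j) \<longlongrightarrow> L $ 2 $ j) F)"
proof
  assume *: "\<forall>j. ((\<lambda>x. f x $ 1 $ j) \<longlongrightarrow> L $ 1 $ j) F \<and> ((\<lambda>x. f x $ 2 $ j) \<longlongrightarrow> L $ 2 $ j) F"
  show "(f \<longlongrightarrow> L) F"
  proof (intro vec_tendstoI)
    fix i j
    show "((\<lambda>x. f x $ i $ j) \<longlongrightarrow> L $ i $ j) F"
      using * exhaust_2[of i] by auto
  qed
qed (blast intro: tendsto_vec_nth[OF tendsto_vec_nth])

text \<open>The phase removes a diagonal term of the system. Multiplication by the opposite phase
  gives the converse, so equations can be rewritten in both directions.\<close>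

lemma has_vector_derivative_exp_mult_iff:
  fixes f :: "real \<Rightarrow> complex"
  shows "((\<lambda>x. exp (\<i> * of_real (\<kappa> * x)) * f x) has_vector_derivative exp (\<i> * of_real (\<kappa> * x)) * g) (at x)
           \<longleftrightarrow> (f has_vector_derivative g - \<i> * of_real \<kappa> * f x) (at x)"
proof -
  have exp: "((\<lambda>x. exp (\<i> * of_real (\<kappa> * x))) has_vector_derivative \<i> * of_real \<kappa> * exp (\<i> * of_real (\<kappa> * x))) (at x)" for \<kappa>
  proof -
    have "((\<lambda>z. exp (\<i> * of_real \<kappa> * z)) has_field_derivative \<i> * of_real \<kappa> * exp (\<i> * of_real (\<kappa> * x))) (at (of_real x))"
      by (auto intro!: derivative_eq_intros simp: mult_ac)
    from has_vector_derivative_real_field[OF this] show ?thesis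
      by (simp add: mult_ac)
  qed
  have inverse: "exp (\<i> * of_real (- \<kappa> * y)) * (exp (\<i> * of_real (\<kappa> * y)) * w) = w" for y w
    by (simp add: mult.assoc[symmetric] flip: exp_add)
  show ?thesis
  proof
    assume "((\<lambda>x. exp (\<i> * of_real (\<kappa> * x)) * f x) has_vector_derivative exp (\<i> * of_real (\<kappa> * x)) * g) (at x)"
    from has_vector_derivative_mult[OF exp[of "- \<kappa>"] this]
    have "(f has_vector_derivative g + \<i> * of_real (- \<kappa>) * f x) (at x)"
      by (simp only: mult.assoc[of "\<i> * of_real (- \<kappa>)"] inverse)
    thus "(f has_vector_derivative g - \<i> * of_real \<kappa> * f x) (at x)"
      by simp
  next
    assume "(f has_vector_derivative g - \<i> * of_real \<kappa> * f x) (at x)"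
    from has_vector_derivative_mult[OF exp[of \<kappa>] this]
    show "((\<lambda>x. exp (\<i> * of_real (\<kappa> * x)) * f x) has_vector_derivative exp (\<i> * of_real (\<kappa> * x)) * g) (at x)"
      by (simp add: algebra_simps)
  qed
qed

text \<open>The equations and Jost normalisation satisfied by a column \<open>(p, r)\<close> of \<open>exp(ikx\<sigma>\<^sub>3) \<Psi>\<close>.\<close>

definition column_system ::
  "(real \<Rightarrow> complex) \<Rightarrow> (real \<Rightarrow> complex) \<Rightarrow> (real \<Rightarrow> complex) \<Rightarrow> (real \<Rightarrow> complex) \<Rightarrow> complex \<Rightarrow> complex \<Rightarrow> bool" where
  "column_system w z p r P R \<longleftrightarrow>
     (\<forall>x. (p has_vector_derivative w x * r x) (at x)) \<and>
     (\<forall>x. (r has_vector_derivative z x * p x) (at x)) \<and>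
     (p \<longlongrightarrow> P) at_top \<and> (r \<longlongrightarrow> R) at_top"

text \<open>The coefficient matrix has zero diagonal, hence zero trace; the Wronskian is constant
  and equals its limit at +infinity.\<close>

lemma column_system_wronskian:
  assumes "column_system w z p1 r1 P1 R1" "column_system w z p2 r2 P2 R2"
  shows "p1 x * r2 x - p2 x * r1 x = P1 * R2 - P2 * R1"
proof -
  define W where "W x = p1 x * r2 x - p2 x * r1 x" for x
  have "(W has_vector_derivative 0) (at x)" for x
  proof -
    have "(W has_vector_derivative (p1 x * (z x * p2 x) + w x * r1 x * r2 x)
             - (p2 x * (z x * p1 x) + w x * r2 x * r1 x)) (at x)"
      using assms unfolding W_def[abs_def] column_system_def
      by (intro has_vector_derivative_diff has_vector_derivative_mult) auto
    thus ?thesis by (simp add: mult_ac)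
  qed
  then obtain C where C: "W x = C" for x
    using has_vector_derivative_zero_constant[of UNIV W] by auto
  have "(W \<longlongrightarrow> P1 * R2 - P2 * R1) at_top"
    using assms unfolding W_def[abs_def] column_system_def by (intro tendsto_intros) auto
  moreover have "W = (\<lambda>_. C)"
    using C by auto
  ultimately have "C = P1 * R2 - P2 * R1"
    by (simp add: tendsto_const_iff)
  thus ?thesis
    using C[of x] by (simp add: W_def)
qed

text \<open>Cramer's rule: the two basis columns have Wronskian 1, and the Wronskians with the third
  column are its coordinates R and P.\<close>

lemma column_system_unique:
  assumes 1: "column_system w z p1 r1 1 0" and 2: "column_system w z p2 r2 0 1"
    and "column_system w z p r P R"
  shows "p x = P * p1 x + R * p2 x" "r x = P * r1 x + R * r2 x"
  using column_system_wronskian[OF 1 2, of x] column_system_wronskian[OF 1 assms(3), of x]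
    column_system_wronskian[OF assms(3) 2, of x]
  by (simp_all, algebra+)

lemma matrix_mult_2_nth:
  fixes X :: "'a::semiring_1 ^ 2 ^ 'm" and Y :: "'a ^ 'p ^ 2"
  shows "(X ** Y) $ i $ j = X $ i $ 1 * Y $ 1 $ j + X $ i $ 2 * Y $ 2 $ j"
  by (simp add: matrix_matrix_mult_def sum_2)

lemma mat2_nth [simp]:
  "mat2 p q r s $ 1 $ 1 = p" "mat2 p q r s $ 1 $ 2 = q"
  "mat2 p q r s $ 2 $ 1 = r" "mat2 p q r s $ 2 $ 2 = s"
  by (simp_all add: mat2_def)

lemma exp_sigma3_mult_nth:
  "(exp_sigma3 k x ** Y) $ 1 $ j = exp (\<i> * of_real (k * x)) * Y $ 1 $ j"
  "(exp_sigma3 k x ** Y) $ 2 $ j = exp (\<i> * of_real (- k * x)) * Y $ 2 $ j"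
  by (simp_all add: matrix_mult_2_nth exp_sigma3_def)

text \<open>Passing to exp(ikx\<sigma>3) \<Psi> cancels the diagonal part and leaves the phases
  exp(2ikx) and exp(-2ikx) off the diagonal. Existence uses one direction of the equivalence,
  uniqueness the other.\<close>

lemma jost_plus_solution_iff_column_system:
  "jost_plus_solution q k c \<Psi> \<longleftrightarrow>
     (\<forall>j. column_system (\<lambda>x. c * q x * exp (\<i> * of_real (2 * k * x))) (\<lambda>x. c * cnj (q x) * exp (- \<i> * of_real (2 * k * x)))
            (\<lambda>x. exp (\<i> * of_real (k * x)) * \<Psi> x $ 1 $ j) (\<lambda>x. exp (\<i> * of_real (- k * x)) * \<Psi> x $ 2 $ j)
            (mat 1 $ 1 $ j) (mat 1 $ 2 $ j))"
proof -
  have entries: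
    "((mat (- \<i> * of_real k) ** sigma3 + potential q c x) ** \<Psi> x) $ 1 $ j
        = c * q x * \<Psi> x $ 2 $ j - \<i> * of_real k * \<Psi> x $ 1 $ j"
    "((mat (- \<i> * of_real k) ** sigma3 + potential q c x) ** \<Psi> x) $ 2 $ j
        = c * cnj (q x) * \<Psi> x $ 1 $ j - \<i> * of_real (- k) * \<Psi> x $ 2 $ j" for x j
    by (simp_all add: matrix_mult_2_nth potential_def sigma3_def mat_def)
  have p: "((\<lambda>x. \<Psi> x $ 1 $ j) has_vector_derivative
             ((mat (- \<i> * of_real k) ** sigma3 + potential q c x) ** \<Psi> x) $ 1 $ j) (at x) \<longleftrightarrow>
           ((\<lambda>x. exp (\<i> * of_real (k * x)) * \<Psi> x $ 1 $ j) has_vector_derivative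
             c * q x * exp (\<i> * of_real (2 * k * x)) * (exp (\<i> * of_real (- k * x)) * \<Psi> x $ 2 $ j)) (at x)" for x j
  proof -
    have "exp (\<i> * of_real (2 * k * x)) * exp (\<i> * of_real (- k * x)) = exp (\<i> * of_real (k * x))"
      by (simp add: algebra_simps flip: exp_add)
    moreover have "c * q x * exp (\<i> * of_real (2 * k * x)) * (exp (\<i> * of_real (- k * x)) * \<Psi> x $ 2 $ j)
        = exp (\<i> * of_real (2 * k * x)) * exp (\<i> * of_real (- k * x)) * (c * q x * \<Psi> x $ 2 $ j)"
      by (simp only: mult_ac)
    ultimately show ?thesis
      unfolding entries by (simp only: has_vector_derivative_exp_mult_iff)
  qed
  have r: "((\<lambda>x. \<Psi> x $ 2 $ j) has_vector_derivative
             ((mat (- \<i> * of_real k) ** sigma3 + potential q c x) ** \<Psi> x) $ 2 $ j) (at x) \<longleftrightarrow>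
           ((\<lambda>x. exp (\<i> * of_real (- k * x)) * \<Psi> x $ 2 $ j) has_vector_derivative
             c * cnj (q x) * exp (- \<i> * of_real (2 * k * x)) * (exp (\<i> * of_real (k * x)) * \<Psi> x $ 1 $ j)) (at x)" for x j
  proof -
    have "exp (- \<i> * of_real (2 * k * x)) * exp (\<i> * of_real (k * x)) = exp (\<i> * of_real (- k * x))"
      by (simp add: algebra_simps flip: exp_add)
    moreover have "c * cnj (q x) * exp (- \<i> * of_real (2 * k * x)) * (exp (\<i> * of_real (k * x)) * \<Psi> x $ 1 $ j)
        = exp (- \<i> * of_real (2 * k * x)) * exp (\<i> * of_real (k * x)) * (c * cnj (q x) * \<Psi> x $ 1 $ j)"
      by (simp only: mult_ac)
    ultimately show ?thesis
      unfolding entries by (simp only: has_vector_derivative_exp_mult_iff)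
  qed
  show ?thesis
    unfolding jost_plus_solution_def column_system_def has_vector_derivative_two_rows_iff tendsto_two_rows_iff
      exp_sigma3_mult_nth p r
    by blast
qed

text \<open>The phase of the profile merges with exp(2ikx) into exp(ilx). Exchanging the two
  components exchanges w and z, which amounts to changing the sign of l; so one pair of functions
  supplies both columns.\<close>

lemma column_system_soliton:
  fixes A V k :: real and c :: complex
  assumes "A > 0" "c \<noteq> 0"
  defines "l \<equiv> 2 * k + V"
  defines "w \<equiv> \<lambda>x. c * soliton_profile A V x * exp (\<i> * of_real (2 * k * x))"
    and "z \<equiv> \<lambda>x. c * cnj (soliton_profile A V x) * exp (- \<i> * of_real (2 * k * x))"
  shows "column_system w z (\<lambda>x. soliton_u A (- l) c (of_real x)) (\<lambda>x. soliton_v A (- l) c (of_real x)) 1 0"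
    and "column_system w z (\<lambda>x. soliton_v A l c (of_real x)) (\<lambda>x. soliton_u A l c (of_real x)) 0 1"
proof -
  have "exp (\<i> * of_real (V * x)) * exp (\<i> * of_real (2 * k * x)) = exp (\<i> * of_real (l * x))"
    "exp (- \<i> * of_real (V * x)) * exp (- \<i> * of_real (2 * k * x)) = exp (- \<i> * of_real (l * x))" for x
    by (simp_all add: l_def algebra_simps flip: exp_add)
  hence w: "w x = c * of_real A * exp (\<i> * of_real (l * x)) / of_real (cosh (A * x))"
    and z: "z x = c * of_real A * exp (- \<i> * of_real (l * x)) / of_real (cosh (A * x))" for x
    unfolding w_def z_def soliton_profile_def by (simp_all add: exp_cnj)
  show "column_system w z (\<lambda>x. soliton_v A l c (of_real x)) (\<lambda>x. soliton_u A l c (of_real x)) 0 1"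
    unfolding column_system_def w z using assms(1,2)
    by (intro conjI allI has_vector_derivative_soliton_u has_vector_derivative_soliton_v
          soliton_u_at_top soliton_v_at_top) auto
  show "column_system w z (\<lambda>x. soliton_u A (- l) c (of_real x)) (\<lambda>x. soliton_v A (- l) c (of_real x)) 1 0"
    using has_vector_derivative_soliton_u[of c A "- l"] has_vector_derivative_soliton_v[of c A "- l"] assms(1,2)
    unfolding column_system_def w z by (auto intro: soliton_u_at_top soliton_v_at_top)
qed

lemma jost_plus_soliton:
  fixes A V k :: real and c :: complex
  assumes "A > 0" "c \<noteq> 0"
  defines "l \<equiv> 2 * k + V"
  shows "exp_sigma3 k x ** jost_plus (soliton_profile A V) k c x =
           mat2 (soliton_u A (- l) c (of_real x)) (soliton_v A l c (of_real x))
                (soliton_v A (- l) c (of_real x)) (soliton_u A l c (of_real x))"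
proof -
  define M where "M x = mat2 (soliton_u A (- l) c (of_real x)) (soliton_v A l c (of_real x))
                (soliton_v A (- l) c (of_real x)) (soliton_u A l c (of_real x))" for x :: real
  \<comment> \<open>\<open>exp_sigma3 (- k) x\<close> is the inverse of
    \<open>exp_sigma3 k x\<close>.\<close>
  define \<Psi> where "\<Psi> x = exp_sigma3 (- k) x ** M x" for x
  define q where "q = soliton_profile A V"
  have cancel: "exp (\<i> * of_real (k * x)) * (exp (\<i> * of_real (- k * x)) * y) = y"
    "exp (\<i> * of_real (- k * x)) * (exp (\<i> * of_real (k * x)) * y) = y" for x y
    by (simp_all add: mult.assoc[symmetric] flip: exp_add)
  have \<Psi>_nth: "\<Psi> x $ 1 $ j = exp (\<i> * of_real (- k * x)) * M x $ 1 $ j"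
    "\<Psi> x $ 2 $ j = exp (\<i> * of_real (k * x)) * M x $ 2 $ j" for x j
    by (simp_all add: \<Psi>_def exp_sigma3_mult_nth)
  note columns = column_system_soliton[OF assms(1,2), of V k, folded l_def q_def]
  have sol: "jost_plus_solution q k c \<Psi>"
    unfolding jost_plus_solution_iff_column_system \<Psi>_nth cancel
    using columns by (auto simp: forall_2 M_def mat_def)
  have "\<Phi> = \<Psi>" if "jost_plus_solution q k c \<Phi>" for \<Phi>
  proof
    fix x
    have "exp (\<i> * of_real (k * x)) * \<Phi> x $ 1 $ j = M x $ 1 $ j \<and>
          exp (\<i> * of_real (- k * x)) * \<Phi> x $ 2 $ j = M x $ 2 $ j" for j
      using column_system_unique[OF columns that[unfolded jost_plus_solution_iff_column_system, rule_format, of j], of x]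
        exhaust_2[of j]
      by (auto simp: M_def mat_def)
    hence "\<Phi> x $ 1 $ j = \<Psi> x $ 1 $ j \<and> \<Phi> x $ 2 $ j = \<Psi> x $ 2 $ j" for j
      unfolding \<Psi>_nth by (metis cancel)
    thus "\<Phi> x = \<Psi> x"
      by (simp add: vec_eq_iff forall_2)
  qed
  \<comment> \<open>The definite description in \<open>jost_plus\<close> is resolved only by
    existence together with uniqueness.\<close>
  hence "jost_plus q k c = \<Psi>"
    unfolding jost_plus_def using sol by (intro the_equality)
  moreover have "exp_sigma3 k x ** \<Psi> x = M x" for x
    unfolding vec_eq_iff forall_2 exp_sigma3_mult_nth \<Psi>_nth cancel by simp
  ultimately show ?thesis
    by (simp add: M_def q_def)
qed

section \<open>The scattering coefficients\<close>

theorem soliton_scattering: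
  fixes A V k :: real and c :: complex
  assumes "A > 0" "c \<noteq> 0"
  defines "\<gamma> \<equiv> 1 / 2 - \<i> / of_real A * (of_real k + of_real V / 2)"
  shows "scattering_a (soliton_profile A V) k c = (Gamma \<gamma>)\<^sup>2 * rGamma (\<gamma> - \<i> * c) * rGamma (\<gamma> + \<i> * c)"
    and "scattering_b (soliton_profile A V) k c =
           - (sin (\<i> * of_real pi * c) / \<i>) / of_real (cosh (pi / A * (k + V / 2)))"
proof -
  define l where "l = 2 * k + V"
  have \<gamma>: "\<gamma> = 1 / 2 - \<i> * complex_of_real (l / (2 * A))"
    using assms(1) by (simp add: \<gamma>_def l_def field_simps)
  have cosh: "cosh (pi / A * (k + V / 2)) = cosh (pi * l / (2 * A))"
    using assms(1) by (intro arg_cong[of _ _ cosh]) (simp add: l_def field_simps)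
  let ?a = "\<lambda>l. (Gamma (1 / 2 - \<i> * complex_of_real (l / (2 * A))))\<^sup>2 *
    rGamma (1 / 2 - \<i> * complex_of_real (l / (2 * A)) - \<i> * c) * rGamma (1 / 2 - \<i> * complex_of_real (l / (2 * A)) + \<i> * c)"
  let ?b = "\<lambda>l. - (sin (\<i> * of_real pi * c) / \<i>) / complex_of_real (cosh (pi * l / (2 * A)))"
  \<comment> \<open>\<open>Lim\<close> is taken of the whole matrix, so the first column must
    converge too, although a and b are read off the second.\<close>
  have "((\<lambda>x. exp_sigma3 k x ** jost_plus (soliton_profile A V) k c x) \<longlongrightarrow>
           mat2 (?a (- l)) (?b l) (?b (- l)) (?a l)) at_bot"
    unfolding jost_plus_soliton[OF assms(1,2)] l_def[symmetric]
    unfolding tendsto_two_rows_iff forall_2 mat2_nth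
    using soliton_u_at_bot[OF assms(1), of l c] soliton_u_at_bot[OF assms(1), of "- l" c]
      soliton_v_at_bot[OF assms(1,2), of l] soliton_v_at_bot[OF assms(1,2), of "- l"]
    by simp
  hence "scattering_matrix (soliton_profile A V) k c = mat2 (?a (- l)) (?b l) (?b (- l)) (?a l)"
    unfolding scattering_matrix_def by (intro tendsto_Lim) simp_all
  thus "scattering_a (soliton_profile A V) k c = (Gamma \<gamma>)\<^sup>2 * rGamma (\<gamma> - \<i> * c) * rGamma (\<gamma> + \<i> * c)"
    and "scattering_b (soliton_profile A V) k c =
           - (sin (\<i> * of_real pi * c) / \<i>) / of_real (cosh (pi / A * (k + V / 2)))"
    unfolding scattering_a_def scattering_b_def \<gamma> cosh by (simp_all only: mat2_nth)
qed

theorem mainTheorem2: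
  fixes A V k :: real and c :: complex and q :: "real \<Rightarrow> complex"
  assumes A_pos: "A > 0"
    and coupling: "(\<exists>g::real. g > 0 \<and> c = of_real g) \<or> (\<exists>g::real. g > 0 \<and> c = \<i> * of_real g)"
    and profile: "q = soliton_profile A V"
  shows
    "scattering_a q k c =
       (Gamma (1/2 - \<i> / of_real A * (of_real k + of_real V / 2)))\<^sup>2 /
       (Gamma (1/2 - \<i> * c - \<i> / of_real A * (of_real k + of_real V / 2)) *
        Gamma (1/2 + \<i> * c - \<i> / of_real A * (of_real k + of_real V / 2)))
     \<and> scattering_b q k c =
       - (sin (\<i> * of_real pi * c) / \<i>) * (1 / of_real (cosh (pi / A * (k + V / 2))))
     \<and> scattering_b q k \<i> = 0
     \<and> (let k1 = - of_real V / 2 + \<i> * of_real A / 2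
        in scattering_a q k \<i> = (of_real k - k1) / (of_real k - cnj k1))"
proof -
  define \<gamma> where "\<gamma> = 1 / 2 - \<i> / of_real A * (of_real k + of_real V / 2)"
  have "c \<noteq> 0"
    using coupling by auto
  note scattering = soliton_scattering[OF A_pos this, of V k, folded \<gamma>_def profile]
    and scattering_i = soliton_scattering[OF A_pos complex_i_not_zero, of V k, folded \<gamma>_def profile]
  have shift: "\<gamma> - \<i> * c = 1/2 - \<i> * c - \<i> / of_real A * (of_real k + of_real V / 2)"
    "\<gamma> + \<i> * c = 1/2 + \<i> * c - \<i> / of_real A * (of_real k + of_real V / 2)"
    by (simp_all add: \<gamma>_def)
  \<comment> \<open>At a pole \<open>Gamma\<close> takes the value 0 and division by 0 gives 0,
    which agrees with the zero of \<open>rGamma\<close>. The quotient form is therefore also right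
    where a vanishes, for example at k = -V/2 with c = i/2.\<close>
  have "scattering_a q k c = (Gamma \<gamma>)\<^sup>2 / (Gamma (\<gamma> - \<i> * c) * Gamma (\<gamma> + \<i> * c))"
    unfolding scattering(1) rGamma_inverse_Gamma by (simp add: divide_inverse)
  hence a: "scattering_a q k c =
       (Gamma (1/2 - \<i> / of_real A * (of_real k + of_real V / 2)))\<^sup>2 /
       (Gamma (1/2 - \<i> * c - \<i> / of_real A * (of_real k + of_real V / 2)) *
        Gamma (1/2 + \<i> * c - \<i> / of_real A * (of_real k + of_real V / 2)))"
    unfolding shift unfolding \<gamma>_def .
  have b_i: "scattering_b q k \<i> = 0"
  proof -
    have "\<i> * complex_of_real pi * \<i> = - of_real pi"
      by (simp add: complex_eq_iff)
    thus ?thesis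
      unfolding scattering_i(2) by simp
  qed
  have a_i: "scattering_a q k \<i> = (of_real k - k1) / (of_real k - cnj k1)"
    if k1: "k1 = - of_real V / 2 + \<i> * of_real A / 2" for k1
  proof -
    have "Re \<gamma> > 0"
      using A_pos by (simp add: \<gamma>_def)
    hence \<gamma>: "rGamma \<gamma> \<noteq> 0" "\<gamma> \<noteq> 0"
      using Re_pos_not_nonpos_Ints[of \<gamma>] by (simp_all only: rGamma_eq_zero_iff) auto
    \<comment> \<open>For c = i the shifts by ic are integers, \<gamma> - ic = \<gamma> + 1 and
      \<gamma> + ic = \<gamma> - 1, so the recurrence collapses all Gamma values to (\<gamma> - 1) /
      \<gamma>.\<close>
    have "scattering_a q k \<i> = (inverse (rGamma \<gamma>))\<^sup>2 * rGamma (\<gamma> + 1) * rGamma (\<gamma> - 1)"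
      unfolding scattering_i(1) Gamma_def by simp
    also have "rGamma (\<gamma> - 1) = (\<gamma> - 1) * rGamma \<gamma>"
      using rGamma_plus1[of "\<gamma> - 1"] by simp
    also have "rGamma (\<gamma> + 1) = rGamma \<gamma> / \<gamma>"
      using rGamma_plus1[of \<gamma>] \<gamma> by (simp add: field_simps)
    also have "(inverse (rGamma \<gamma>))\<^sup>2 * (rGamma \<gamma> / \<gamma>) * ((\<gamma> - 1) * rGamma \<gamma>) = (\<gamma> - 1) / \<gamma>"
      using \<gamma> by (simp add: power2_eq_square divide_simps)
    finally have "scattering_a q k \<i> = (\<gamma> - 1) / \<gamma>" .
    \<comment> \<open>Scaling by iA carries \<gamma> to k - cnj k1 and \<gamma> - 1 to k -
      k1.\<close>
    moreover have "\<i> * of_real A * \<gamma> = \<i> * of_real A / 2 + (of_real k + of_real V / 2)"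
      using A_pos by (simp add: \<gamma>_def right_diff_distrib)
    hence "of_real k - k1 = \<i> * of_real A * (\<gamma> - 1)" "of_real k - cnj k1 = \<i> * of_real A * \<gamma>"
      by (simp_all add: k1 right_diff_distrib)
    ultimately show ?thesis
      using A_pos by simp
  qed
  show ?thesis
    unfolding Let_def
  proof (intro conjI a b_i a_i[OF refl])
    show "scattering_b q k c =
        - (sin (\<i> * of_real pi * c) / \<i>) * (1 / of_real (cosh (pi / A * (k + V / 2))))"
      by (simp only: scattering(2) divide_inverse mult_1)
  qed
qed

end
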